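(* Let $p>1$ be a real number. There exists a constant $C_p>0$, depending only on $p$, such that for every weight $w$ on $\mathbb{R}^2$, with $W=\mathfrak{M}_{\mathcal{R}}\mathfrak{M}_{\mathcal{Q}}w$ (i.e. $W=\mathfrak{M}_{\mathcal{R}}(\mathfrak{M}_{\mathcal{Q}}w)$), $$ \|\mathfrak{M}_{\mathcal{R}}f\|_{L^p(\mathbb{R}^2,w)}\le C_p\,\|f\|_{L^p(\mathbb{R}^2,W)} $$ holds for all $f\in L^p(\mathbb{R}^2,W)$.
   Context: A weight on $\mathbb{R}^2$ is a non-negative locally integrable function on $\mathbb{R}^2$. $|E|$ is the Lebesgue measure of $E$ and $\mathbf{1}_E$ its characteristic function. For $0<p<\infty$, $L^p(\mathbb{R}^2,w)$ is the weighted Lebesgue space with $$\|f\|_{L^p(\mathbb{R}^2,w)}=\left(\int_{\mathbb{R}^2}|f(x)|^p w(x)\,dx\right)^{1/p},$$ and similarly with $W$ in place of $w$. $\mathcal{Q}$ is the set of all cubes (squares) in $\mathbb{R}^2$, with sides not necessarily parallel to the axes. The Hardy-Littlewood maximal operator is $$\mathfrak{M}_{\mathcal{Q}}f(x)=\sup_{Q\in\mathcal{Q}}\mathbf{1}_Q(x)\frac{1}{|Q|}\int_Q|f(y)|\,dy .$$ $\mathcal{R}$ is the set of all rectangles in $\mathbb{R}^2$ with sides parallel to the coordinate axes. The strong maximal operator is $$\mathfrak{M}_{\mathcal{R}}f(x)=\sup_{R\in\mathcal{R}}\mathbf{1}_R(x)\frac{1}{|R|}\int_R|f(y)|\,dy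 .$$ The same formulas are used for arbitrary measurable functions (e.g. $\mathfrak{M}_{\mathcal{Q}}w$, with values in $[0,\infty]$); integrals of non-negative functions take values in $[0,\infty]$, with the convention $0\cdot\infty=0$. *)

theory Defs
  imports "HOL-Analysis.Analysis"
begin

definition is_weight :: "(real^2 \<Rightarrow> real) \<Rightarrow> bool" where
  "is_weight w \<longleftrightarrow>
     (\<forall>x. 0 \<le> w x) \<and> (\<forall>K. compact K \<longrightarrow> set_integrable lebesgue K w)"

(* Real powers on [0,\<infinity>]; used only for exponents a > 0, so that 0 maps to 0
   and \<infinity> to \<infinity>. *)
definition ennreal_powr :: "ennreal \<Rightarrow> real \<Rightarrow> ennreal" where
  "ennreal_powr t a = (if t = \<infinity> then \<infinity> else ennreal (enn2real t powr a))"

definition squares :: "(real^2) set set" where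
  "squares = {Q. \<exists>c u v l. norm u = 1 \<and> norm v = 1 \<and> u \<bullet> v = 0 \<and> 0 < l \<and>
     Q = {c + s *\<^sub>R u + t *\<^sub>R v | s t. 0 \<le> s \<and> s \<le> l \<and> 0 \<le> t \<and> t \<le> l}}"

definition axis_rectangles :: "(real^2) set set" where
  "axis_rectangles = {R. \<exists>a b. (\<forall>i. a $ i < b $ i) \<and> R = cbox a b}"

(* The operators below act on the modulus of a function, given as an ennreal-valued
   function; this makes iterated maximal functions, which may take the value \<infinity>,
   meaningful.  A finite function f enters as emod f. *)
definition emod :: "(real^2 \<Rightarrow> 'b::real_normed_vector) \<Rightarrow> real^2 \<Rightarrow> ennreal" where
  "emod f x = ennreal (norm (f x))"

definition maximal_op ::
    "(real^2) set set \<Rightarrow> (real^2 \<Rightarrow> ennreal) \<Rightarrow> real^2 \<Rightarrow> ennreal" where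
  "maximal_op \<B> g x =
     (SUP B\<in>\<B>. indicator B x * ((\<integral>\<^sup>+y\<in>B. g y \<partial>lebesgue) / emeasure lebesgue B))"

abbreviation HL_maximal :: "(real^2 \<Rightarrow> ennreal) \<Rightarrow> real^2 \<Rightarrow> ennreal" where
  "HL_maximal \<equiv> maximal_op squares"

abbreviation strong_maximal :: "(real^2 \<Rightarrow> ennreal) \<Rightarrow> real^2 \<Rightarrow> ennreal" where
  "strong_maximal \<equiv> maximal_op axis_rectangles"

definition weighted_Lp_norm ::
    "real \<Rightarrow> (real^2 \<Rightarrow> ennreal) \<Rightarrow> (real^2 \<Rightarrow> ennreal) \<Rightarrow> ennreal" where
  "weighted_Lp_norm p v g =
     ennreal_powr (\<integral>\<^sup>+x. ennreal_powr (g x) p * v x \<partial>lebesgue) (1 / p)"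

definition weighted_Lp :: "real \<Rightarrow> (real^2 \<Rightarrow> ennreal) \<Rightarrow> (real^2 \<Rightarrow> complex) set" where
  "weighted_Lp p v =
     {f. f \<in> borel_measurable lebesgue \<and> weighted_Lp_norm p v (emod f) < \<infinity>}"

end

(* Let u be the maximal function of w over axis-parallel squares and W the strong maximal function
   of u. By symmetry it suffices to consider wide rectangles, those with horizontal side at least
   the vertical one. From finitely many wide rectangles R whose averages of f exceed t, the
   Cordoba-Fefferman selection, by decreasing width, extracts almost disjoint rectangles T such that
   every R is, in each vertical fibre, at least half covered by the union Omega of the
   horizontally tripled T. Hence every point of R lies in a square that is half contained in Omega,
   and the Vitali covering lemma gives w(union of the R) <= 18 * (integral of u over Omega). The
   integral of u over a tripled T is at most |T| times 3 inf_T W, while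
   t^q inf_T W <= (average over T of f W^(1/q))^q; summing over the almost disjoint T, the unweighted
   L^q bound for the iterated one-dimensional maximal function of f W^(1/q) gives the weak type
   (q,q) inequality with weights w and W, for every q > 1. Interpolating with the trivial bound for
   bounded functions yields the strong type (p,p) inequality. *)

theory Submission
  imports Defs
begin

section \<open>Real powers and dyadic sums\<close>

text \<open>The weight \<open>w\<close> need not be doubling, so its mass on enlarged or merely
  overlapping sets is not controlled by its mass on the selected ones. Each enlargement is paid for
  by a maximal function instead: squares turn \<open>w\<close> into \<open>u\<close>, rectangles
  turn \<open>u\<close> into \<open>W\<close>. Once W^(1/q) is inside the average of
  \<open>f\<close>, only Lebesgue measure is left, for which the iterated maximal function is
  bounded. Ranking by width is what lets squares suffice: a selected rectangle that meets an
  \<open>R\<close> of at most its width spans, once tripled horizontally, the whole base of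
  \<open>R\<close>, so the same heights are covered over every point of the base. A square as high
  as \<open>R\<close> can slide along the base and stay half covered; it fits because
  \<open>R\<close> is wide. Maximal functions over uncountable families are never shown measurable:
  \<open>W\<close> is bounded below, and the maximal function of \<open>f\<close> above, by rational
  versions, and each is needed in that direction only.\<close>

lemma ennreal_powr_ennreal: "0 \<le> r \<Longrightarrow> ennreal_powr (ennreal r) a = ennreal (r powr a)"
  by (simp add: ennreal_powr_def)

lemma ennreal_powr_top [simp]: "ennreal_powr top a = top"
  by (simp add: ennreal_powr_def)

lemma ennreal_powr_zero [simp]: "ennreal_powr 0 a = 0"
  by (simp add: ennreal_powr_def)

lemma ennreal_powr_one [simp]: "ennreal_powr t 1 = t"
  by (cases t) (auto simp: ennreal_powr_ennreal)

lemma ennreal_powr_mono: "0 < a \<Longrightarrow> s \<le> t \<Longrightarrow> ennreal_powr s a \<le> ennreal_powr t a"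
  by (cases s; cases t) (auto simp: ennreal_powr_ennreal top_unique intro!: ennreal_leI powr_mono2)

lemma ennreal_powr_mult:
  "0 < a \<Longrightarrow> ennreal_powr (s * t) a = ennreal_powr s a * ennreal_powr t a"
proof (cases s; cases t)
  fix r r' assume "0 < a" "0 \<le> r" "s = ennreal r" "0 \<le> r'" "t = ennreal r'"
  then show ?thesis
    by (simp add: ennreal_powr_ennreal powr_mult flip: ennreal_mult)
qed (auto simp: ennreal_powr_ennreal ennreal_mult_top ennreal_top_mult)

lemma ennreal_powr_powr: "ennreal_powr (ennreal_powr t a) b = ennreal_powr t (a * b)"
  by (cases t) (auto simp: ennreal_powr_ennreal powr_powr)

lemma measurable_ennreal_powr [measurable (raw)]:
  assumes [measurable]: "f \<in> borel_measurable M"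
  shows "(\<lambda>x. ennreal_powr (f x) a) \<in> borel_measurable M"
  unfolding ennreal_powr_def by measurable

lemma ennreal_powr_max:
  "0 < a \<Longrightarrow> ennreal_powr (max s t) a \<le> ennreal_powr s a + ennreal_powr t a"
  by (cases "s \<le> t") (auto simp: max_def)

section \<open>Dyadic decomposition and interpolation\<close>

lemma exists_dyadic:
  fixes r :: real assumes "0 < r"
  obtains k :: int where "2 powr k < r" "r \<le> 2 powr (k + 1)"
proof
  \<comment> \<open>Ceiling minus one rather than floor: the lower inequality has to be strict even
    when \<open>r\<close> is a power of two, because it places \<open>r\<close> in the superlevel
    set at height 2^k.\<close>
  let ?k = "\<lceil>log 2 r\<rceil> - 1"
  have r: "2 powr (log 2 r) = r" using assms by simp
  have "real_of_int ?k < log 2 r" "log 2 r \<le> real_of_int ?k + 1" by linarith+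
  then show "2 powr ?k < r" "r \<le> 2 powr (?k + 1)"
    using r powr_less_mono[of "real_of_int ?k" "log 2 r" 2]
      powr_mono[of "log 2 r" "real_of_int ?k + 1" 2] by auto
qed

lemma count_space_term_le:
  fixes f :: "'a \<Rightarrow> ennreal" shows "f k \<le> (\<integral>\<^sup>+k. f k \<partial>count_space UNIV)"
proof -
  have "f k = (\<integral>\<^sup>+j. f j * indicator {k} j \<partial>count_space UNIV)"
    by (subst nn_integral_count_space_indicator[symmetric])
       (auto simp: nn_integral_count_space_finite)
  also have "\<dots> \<le> (\<integral>\<^sup>+k. f k \<partial>count_space UNIV)"
    by (intro nn_integral_mono) (auto simp: indicator_def)
  finally show ?thesis .
qed

lemma ennreal_eq_topI:
  fixes x :: ennreal assumes "\<And>n::real. 0 < n \<Longrightarrow> ennreal n \<le> x" shows "x = top"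
proof (cases x)
  case (real r)
  then show ?thesis using assms[of "r + 1"] by (simp add: ennreal_le_iff)
qed

text \<open>For finite nonzero F the single summand with 2^k < F \<le> 2^(k+1) dominates F^p. The
  sum is written as an integral over counting measure so that Tonelli can exchange it with the
  integral in x.\<close>

lemma powr_le_dyadic_sum:
  fixes F :: ennreal assumes "0 < p"
  shows "ennreal_powr F p \<le>
    (\<integral>\<^sup>+k. ennreal (2 powr ((of_int k + 1) * p)) * of_bool (ennreal (2 powr of_int k) < F)
      \<partial>count_space (UNIV :: int set))" (is "_ \<le> (\<integral>\<^sup>+k. ?f k \<partial>_)")
proof (cases F)
  case (real r)
  show ?thesis
  proof (cases "r = 0")
    case False
    then have "0 < r" using real by simp
    then obtain k :: int where k: "2 powr k < r" "r \<le> 2 powr (k + 1)"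
      by (rule exists_dyadic)
    have "r powr p \<le> (2 powr (k + 1)) powr p"
      using k \<open>0 < r\<close> assms by (intro powr_mono2) auto
    then have "ennreal_powr F p \<le> ?f k"
      using real k \<open>0 < r\<close>
      by (simp add: ennreal_powr_ennreal powr_powr ennreal_less_iff ennreal_leI)
    also have "\<dots> \<le> (\<integral>\<^sup>+k. ?f k \<partial>count_space UNIV)" by (rule count_space_term_le)
    finally show ?thesis .
  qed (use real in simp)
next
  case top
  \<comment> \<open>For F infinite no level is excluded, so the summand whose factor 2^((k+1)p)
    exceeds a given n bounds the sum from below by n.\<close>
  have "ennreal n \<le> (\<integral>\<^sup>+k. ?f k \<partial>count_space UNIV)" if "0 < n" for n
  proof -
    obtain k :: int where k: "2 powr k < n powr (1/p)" "n powr (1/p) \<le> 2 powr (k + 1)"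
      using \<open>0 < n\<close> by (auto intro: exists_dyadic[of "n powr (1/p)"])
    have "(n powr (1/p)) powr p \<le> (2 powr (k + 1)) powr p"
      using k assms by (intro powr_mono2) auto
    then have "ennreal n \<le> ?f k"
      using top assms \<open>0 < n\<close> by (simp add: powr_powr ennreal_leI)
    then show ?thesis using count_space_term_le[of ?f k] by (rule order_trans)
  qed
  then have "(\<integral>\<^sup>+k. ?f k \<partial>count_space UNIV) = top"
    by (intro ennreal_eq_topI) auto
  then show ?thesis by simp
qed

text \<open>The indicator removes all k > m + 1, where 2^m < F \<le> 2^(m+1). Below that the weights
  2^(k(p-q)) decay geometrically since q < p, so the sum is comparable to its top term, of order
  F^(p-q) F^q. The constant blows up as q tends to p.\<close>

lemma dyadic_tail_sum_le:
  fixes F :: ennreal assumes q: "0 < q" and pq: "q < p"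
  shows "(\<integral>\<^sup>+k. ennreal (2 powr ((of_int k + 1) * p)) * (ennreal (2 powr (- of_int k * q)) *
            (ennreal_powr F q * of_bool (ennreal (2 powr (of_int k - 1)) < F)))
      \<partial>count_space (UNIV :: int set))
    \<le> ennreal (2 powr (2 * p - q) / (1 - 2 powr (q - p))) * ennreal_powr F p"
    (is "(\<integral>\<^sup>+k. ?f k \<partial>_) \<le> ennreal ?C * _")
proof (cases F)
  case (real r)
  show ?thesis
  proof (cases "r = 0")
    case True
    then show ?thesis using real by simp
  next
    case False
    then have "0 < r" using real by simp
    then obtain m :: int where m: "2 powr m < r" "r \<le> 2 powr (m + 1)"
      by (rule exists_dyadic)
    \<comment> \<open>With k = m + 1 - j, the summand at j = 0 is at most \<open>c\<close>, and each
      step downwards multiplies the bound by \<open>z\<close>.\<close>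
    define z where "z = (2::real) powr (q - p)"
    have z: "0 < z" "z < 1" using pq unfolding z_def by (auto simp: powr_less_one)
    define c where "c = 2 powr p * 2 powr ((m + 1) * (p - q)) * r powr q"
    have "?f k = 0" if "k \<notin> (\<lambda>j. m + 1 - int j) ` UNIV" for k
    proof -
      have "k > m + 1"
      proof (rule ccontr)
        assume "\<not> m + 1 < k"
        then have "k = m + 1 - int (nat (m + 1 - k))" by simp
        then show False using that by blast
      qed
      then have k: "2 powr (m + 1) \<le> (2::real) powr (of_int k - 1)" by (intro powr_mono) auto
      have "\<not> ennreal (2 powr (of_int k - 1)) < F"
        using order_trans[OF _ k, of r] m real by (simp add: ennreal_less_iff not_less add.commute)
      then show ?thesis by simp
    qed
    then have "(\<integral>\<^sup>+k. ?f k \<partial>count_space UNIV) =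
        (\<integral>\<^sup>+k. ?f k \<partial>count_space ((\<lambda>j. m + 1 - int j) ` UNIV))"
      by (subst (2) nn_integral_count_space_indicator)
         (auto intro!: nn_integral_cong simp: indicator_def)
    also have "\<dots> = (\<integral>\<^sup>+j. ?f (m + 1 - int j) \<partial>count_space UNIV)"
      by (subst nn_integral_bij_count_space[symmetric, of "\<lambda>j. m + 1 - int j" UNIV])
         (auto simp: bij_betw_def inj_on_def)
    also have "\<dots> \<le> (\<integral>\<^sup>+j. ennreal (c * z ^ j) \<partial>count_space UNIV)"
    proof (intro nn_integral_mono)
      fix j :: nat
      have "?f (m + 1 - int j) \<le> ennreal (2 powr ((of_int (m + 1 - int j) + 1) * p)) *
          (ennreal (2 powr (- of_int (m + 1 - int j) * q)) * ennreal (r powr q))"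
        using real \<open>0 < r\<close> by (intro mult_left_mono) (auto simp: ennreal_powr_ennreal of_bool_def)
      also have "\<dots> = ennreal (2 powr ((of_int (m + 1 - int j) + 1) * p) *
          (2 powr (- of_int (m + 1 - int j) * q) * r powr q))"
        by (simp add: ennreal_mult)
      also have "2 powr ((of_int (m + 1 - int j) + 1) * p) *
          (2 powr (- of_int (m + 1 - int j) * q) * r powr q) = c * z ^ j"
        unfolding c_def z_def
        by (simp add: powr_realpow[symmetric] powr_powr flip: powr_add) (simp add: algebra_simps)
      finally show "?f (m + 1 - int j) \<le> ennreal (c * z ^ j)" .
    qed
    also have "\<dots> = (\<Sum>j. ennreal (c * z ^ j))" by (rule nn_integral_count_space_nat)
    also have "\<dots> = ennreal (\<Sum>j. c * z ^ j)"
      using z by (intro suminf_ennreal2) (auto simp: c_def intro!: summable_mult summable_geometric)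
    also have "(\<Sum>j. c * z ^ j) = c / (1 - z)"
      using z by (simp add: suminf_mult suminf_geometric summable_geometric)
    \<comment> \<open>Since 2^(m+1) < 2r, \<open>c\<close> is at most 2^p (2r)^(p-q) r^q, which
      explains the numerator 2^(2p-q).\<close>
    also have "c / (1 - z) \<le> ?C * r powr p"
    proof -
      have e: "2 powr ((m + 1) * (p - q)) = (2 * 2 powr m) powr (p - q)"
        by (simp add: powr_powr flip: powr_add) (simp add: powr_add[symmetric] powr_powr powr_mult algebra_simps)
      have "(2 * 2 powr m) powr (p - q) \<le> (2 * r) powr (p - q)"
        using m pq by (intro powr_mono2) auto
      then have "c \<le> 2 powr p * (2 * r) powr (p - q) * r powr q"
        unfolding c_def e by (intro mult_right_mono mult_left_mono) auto
      also have "\<dots> = 2 powr (2 * p - q) * r powr p"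
        using \<open>0 < r\<close> by (simp add: powr_mult powr_diff powr_add[symmetric] field_simps)
      finally show ?thesis
        using z divide_right_mono[of c "2 powr (2 * p - q) * r powr p" "1 - z"] unfolding z_def[symmetric] by simp
    qed
    finally show ?thesis
      using real \<open>0 < r\<close> z unfolding z_def
      by (simp add: ennreal_powr_ennreal ennreal_leI flip: ennreal_mult)
  qed
next
  case top
  have "2 powr (q - p) < (1::real)" using pq by (simp add: powr_less_one)
  then have "0 < ?C" by simp
  then show ?thesis using top pq by (simp add: ennreal_mult_top)
qed

text \<open>The weak bound at t = 2^k sees only the part of \<open>f\<close> above 2^(k-1); summing
  over k before integrating turns these truncations into f^p by \<open>dyadic_tail_sum_le\<close>.
  Two measures are allowed because the two sides of the final inequality carry different
  weights.\<close>

lemma marcinkiewicz_dyadic: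
  assumes q: "0 < q" and pq: "q < p" and [measurable]: "F \<in> borel_measurable M" "f \<in> borel_measurable N"
    and weak: "\<And>t. 0 < t \<Longrightarrow> emeasure M {x \<in> space M. ennreal t < F x}
      \<le> ennreal (t powr - q) * (C * (\<integral>\<^sup>+x. ennreal_powr (f x) q * of_bool (ennreal (t / 2) < f x) \<partial>N))"
  shows "(\<integral>\<^sup>+x. ennreal_powr (F x) p \<partial>M)
    \<le> ennreal (2 powr (2 * p - q) / (1 - 2 powr (q - p))) * (C * (\<integral>\<^sup>+x. ennreal_powr (f x) p \<partial>N))"
proof -
  let ?a = "\<lambda>k::int. ennreal (2 powr ((of_int k + 1) * p))"
  let ?b = "\<lambda>k::int. ennreal (2 powr (- of_int k * q))"
  let ?h = "\<lambda>k x. ennreal_powr (f x) q * of_bool (ennreal (2 powr (of_int (k::int) - 1)) < f x)"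
  let ?I = "\<lambda>k x. of_bool (ennreal (2 powr of_int (k::int)) < F x) :: ennreal"
  have "(\<integral>\<^sup>+x. ennreal_powr (F x) p \<partial>M) \<le> (\<integral>\<^sup>+x. (\<integral>\<^sup>+k. ?a k * ?I k x \<partial>count_space UNIV) \<partial>M)"
    using q pq by (intro nn_integral_mono powr_le_dyadic_sum) auto
  also have "\<dots> = (\<integral>\<^sup>+k. (\<integral>\<^sup>+x. ?a k * ?I k x \<partial>M) \<partial>count_space UNIV)"
    by (rule nn_integral_count_space_nn_integral) auto
  also have "\<dots> \<le> (\<integral>\<^sup>+k. C * (\<integral>\<^sup>+x. ?a k * (?b k * ?h k x) \<partial>N) \<partial>count_space UNIV)"
  proof (intro nn_integral_mono)
    fix k :: int
    have "(\<integral>\<^sup>+x. ?a k * ?I k x \<partial>M) = ?a k * (\<integral>\<^sup>+x. ?I k x \<partial>M)"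
      by (rule nn_integral_cmult) auto
    also have "(\<integral>\<^sup>+x. ?I k x \<partial>M) =
        (\<integral>\<^sup>+x. indicator {x \<in> space M. ennreal (2 powr of_int k) < F x} x \<partial>M)"
      by (intro nn_integral_cong) (simp add: indicator_def)
    also have "\<dots> = emeasure M {x \<in> space M. ennreal (2 powr of_int k) < F x}"
      by (rule nn_integral_indicator) measurable
    also have "\<dots> \<le> ?b k * (C * (\<integral>\<^sup>+x. ?h k x \<partial>N))"
      using weak[of "2 powr of_int k"] by (simp add: powr_powr powr_diff)
    also have "?a k * (?b k * (C * (\<integral>\<^sup>+x. ?h k x \<partial>N))) = C * (\<integral>\<^sup>+x. ?a k * (?b k * ?h k x) \<partial>N)"
      by (subst nn_integral_cmult, measurable, subst nn_integral_cmult, measurable) (simp only: mult_ac)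
    finally show "(\<integral>\<^sup>+x. ?a k * ?I k x \<partial>M) \<le> C * (\<integral>\<^sup>+x. ?a k * (?b k * ?h k x) \<partial>N)"
      by (simp add: mult_left_mono)
  qed
  also have "\<dots> = C * (\<integral>\<^sup>+k. (\<integral>\<^sup>+x. ?a k * (?b k * ?h k x) \<partial>N) \<partial>count_space UNIV)"
    by (rule nn_integral_cmult) auto
  also have "(\<integral>\<^sup>+k. (\<integral>\<^sup>+x. ?a k * (?b k * ?h k x) \<partial>N) \<partial>count_space UNIV) =
      (\<integral>\<^sup>+x. (\<integral>\<^sup>+k. ?a k * (?b k * ?h k x) \<partial>count_space UNIV) \<partial>N)"
    by (rule nn_integral_count_space_nn_integral[symmetric]) auto
  also have "\<dots> \<le> (\<integral>\<^sup>+x. ennreal (2 powr (2 * p - q) / (1 - 2 powr (q - p))) * ennreal_powr (f x) p \<partial>N)"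
    by (intro nn_integral_mono dyadic_tail_sum_le q pq)
  also have "\<dots> = ennreal (2 powr (2 * p - q) / (1 - 2 powr (q - p))) * (\<integral>\<^sup>+x. ennreal_powr (f x) p \<partial>N)"
    by (rule nn_integral_cmult) auto
  finally show ?thesis by (simp add: mult_left_mono mult.left_commute)
qed

section \<open>Selection principles and maximal functions\<close>

text \<open>Greedy choice by decreasing \<open>s\<close>: a rejected set meets one chosen earlier,
  hence one at least as large. Nonemptiness lets a chosen set be its own witness.\<close>

lemma vitali_selection:
  fixes s :: "'i \<Rightarrow> real" and A :: "'i \<Rightarrow> 'a set"
  assumes "finite F"
  obtains S where "S \<subseteq> F" "disjoint_family_on A S"
    "\<And>R. R \<in> F \<Longrightarrow> A R \<noteq> {} \<Longrightarrow> \<exists>T\<in>S. A R \<inter> A T \<noteq> {} \<and> s R \<le> s T"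
proof -
  have "\<exists>S\<subseteq>F. disjoint_family_on A S \<and>
      (\<forall>R\<in>F. A R \<noteq> {} \<longrightarrow> (\<exists>T\<in>S. A R \<inter> A T \<noteq> {} \<and> s R \<le> s T))"
    using assms
  \<comment> \<open>Ranking by \<open>- s\<close> makes the inserted \<open>R\<close> the smallest,
    so everything already in \<open>S\<close> has size at least \<open>s R\<close>.\<close>
  proof (induction F rule: finite_ranking_induct[where f = "\<lambda>R. - s R"])
    case empty
    show ?case by (auto simp: disjoint_family_on_def)
  next
    case (insert R F)
    then obtain S where S: "S \<subseteq> F" "disjoint_family_on A S"
      "\<And>R. R \<in> F \<Longrightarrow> A R \<noteq> {} \<Longrightarrow> \<exists>T\<in>S. A R \<inter> A T \<noteq> {} \<and> s R \<le> s T" by blast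
    show ?case
    proof (cases "\<exists>T\<in>S. A R \<inter> A T \<noteq> {}")
      case True
      then have "\<exists>T\<in>S. A R \<inter> A T \<noteq> {} \<and> s R \<le> s T" using S(1) insert(2) by force
      then show ?thesis using S by (intro exI[of _ S]) auto
    next
      case False
      then have "disjoint_family_on A (insert R S)"
        using S(2) unfolding disjoint_family_on_def by (auto simp: Int_commute)
      then show ?thesis using S(1,3) by (intro exI[of _ "insert R S"]) auto
    qed
  qed
  then show ?thesis using that by blast
qed

text \<open>The selection of Cordoba and Fefferman.\<close>

lemma half_covered_selection:
  fixes s :: "'i \<Rightarrow> real" and A :: "'i \<Rightarrow> 'a set"
  assumes "finite F" and [measurable]: "\<And>R. A R \<in> sets M"
  obtains S E where "S \<subseteq> F" "disjoint_family_on E S"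
    "\<And>T. T \<in> S \<Longrightarrow> E T \<subseteq> A T \<and> E T \<in> sets M \<and> emeasure M (A T) \<le> 2 * emeasure M (E T)"
    "\<And>R. R \<in> F \<Longrightarrow> R \<notin> S \<Longrightarrow> emeasure M (A R) \<le> 2 * emeasure M (A R \<inter> (\<Union>T\<in>{T\<in>S. s R \<le> s T}. A T))"
proof -
  have "\<exists>S\<subseteq>F. \<exists>E. disjoint_family_on E S \<and>
      (\<forall>T\<in>S. E T \<subseteq> A T \<and> E T \<in> sets M \<and> emeasure M (A T) \<le> 2 * emeasure M (E T)) \<and>
      (\<forall>R\<in>F. R \<notin> S \<longrightarrow> emeasure M (A R) \<le> 2 * emeasure M (A R \<inter> (\<Union>T\<in>{T\<in>S. s R \<le> s T}. A T)))"
    (is "\<exists>S\<subseteq>F. \<exists>E. ?P F S E")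
    using assms(1)
  proof (induction F rule: finite_ranking_induct[where f = "\<lambda>R. - s R"])
    case empty
    show ?case by (auto simp: disjoint_family_on_def)
  next
    case (insert R F)
    then obtain S E where SF: "S \<subseteq> F" and P: "?P F S E" by blast
    have eq: "{T \<in> S. s R \<le> s T} = S" using insert(2) SF by auto
    have [measurable]: "(\<Union>T\<in>S. A T) \<in> sets M"
      using finite_subset[OF SF \<open>finite F\<close>] by (intro sets.finite_UN) auto
    show ?case
    \<comment> \<open>The induction may insert an \<open>R\<close> that is already present; nothing
      changes then.\<close>
    proof (cases "R \<in> F \<or> emeasure M (A R) \<le> 2 * emeasure M (A R \<inter> (\<Union>T\<in>S. A T))")
      case True
      then have "?P (insert R F) S E" using P eq by auto
      then show ?thesis using SF by blast
    next
      case False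
      then have "R \<notin> F" and less: "2 * emeasure M (A R \<inter> (\<Union>T\<in>S. A T)) < emeasure M (A R)" by auto
      have "R \<notin> S" using \<open>R \<notin> F\<close> SF by auto
      \<comment> \<open>\<open>R\<close> is selected only when the earlier sets cover less than half
        of it, so the uncovered remainder keeps at least half its measure; it is disjoint from each
        earlier \<open>E T\<close>, which lies in \<open>A T\<close>.\<close>
      define E' where "E' T = (if T = R then A R - (\<Union>T\<in>S. A T) else E T)" for T
      have E': "E' R = A R - (\<Union>T\<in>S. A T)" "\<And>T. T \<in> S \<Longrightarrow> E' T = E T"
        using \<open>R \<notin> S\<close> by (auto simp: E'_def)
      have split: "emeasure M (A R) = emeasure M (A R \<inter> (\<Union>T\<in>S. A T)) + emeasure M (A R - (\<Union>T\<in>S. A T))"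
        by (subst plus_emeasure) (auto intro!: arg_cong[of _ _ "emeasure M"])
      have "emeasure M (A R) \<le> 2 * emeasure M (A R - (\<Union>T\<in>S. A T))"
      proof -
        have "emeasure M (A R \<inter> (\<Union>T\<in>S. A T)) \<le> emeasure M (A R - (\<Union>T\<in>S. A T))"
        proof (rule ccontr)
          assume "\<not> ?thesis"
          then have "emeasure M (A R) \<le> emeasure M (A R \<inter> (\<Union>T\<in>S. A T)) + emeasure M (A R \<inter> (\<Union>T\<in>S. A T))"
            unfolding split by (intro add_left_mono) auto
          then show False using less by (simp add: mult_2)
        qed
        then show ?thesis unfolding split by (simp add: mult_2 add_right_mono)
      qed
      moreover have "disjoint_family_on E' (insert R S)"
      proof -
        have "E T \<inter> (A R - (\<Union>T\<in>S. A T)) = {}" if "T \<in> S" for T using P that by blast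
        then show ?thesis using P E' unfolding disjoint_family_on_def by (simp add: Int_commute)
      qed
      moreover have "emeasure M (A R') \<le> 2 * emeasure M (A R' \<inter> (\<Union>T\<in>{T\<in>insert R S. s R' \<le> s T}. A T))"
        if "R' \<in> F" "R' \<notin> S" for R'
      proof -
        have "emeasure M (A R') \<le> 2 * emeasure M (A R' \<inter> (\<Union>T\<in>{T\<in>S. s R' \<le> s T}. A T))"
          using P that by blast
        also have "\<dots> \<le> 2 * emeasure M (A R' \<inter> (\<Union>T\<in>{T\<in>insert R S. s R' \<le> s T}. A T))"
          using finite_subset[OF SF \<open>finite F\<close>]
          by (intro mult_left_mono emeasure_mono sets.Int sets.finite_UN) auto
        finally show ?thesis .
      qed
      moreover have "E' R \<subseteq> A R" "E' R \<in> sets M" unfolding E' by auto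
      ultimately have "?P (insert R F) (insert R S) E'" using P E' by simp
      then show ?thesis using SF by blast
    qed
  qed
  then obtain S E where "S \<subseteq> F" "?P F S E" by blast
  then show ?thesis using that[of S E] by blast
qed

text \<open>Continuity from below. It lets the selections, which rank finite families, control whole
  superlevel sets.\<close>

lemma emeasure_UN_le_if_finite:
  assumes "countable \<F>" "\<F> \<subseteq> sets M"
    and fin: "\<And>F. finite F \<Longrightarrow> F \<subseteq> \<F> \<Longrightarrow> emeasure M (\<Union>F) \<le> B"
  shows "emeasure M (\<Union>\<F>) \<le> B"
proof (cases "\<F> = {}")
  case True
  then show ?thesis by simp
next
  case False
  define F where "F n = from_nat_into \<F> ` {..n}" for n :: nat
  have F: "finite (F n)" "F n \<subseteq> \<F>" for n
    unfolding F_def using from_nat_into[OF False] by auto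
  have "(\<Union>n. \<Union>(F n)) = \<Union>\<F>"
    unfolding F_def by (subst (2) range_from_nat_into[OF False assms(1), symmetric]) auto
  moreover have "(SUP n. emeasure M (\<Union>(F n))) = emeasure M (\<Union>n. \<Union>(F n))"
  proof (rule SUP_emeasure_incseq)
    show "range (\<lambda>n. \<Union>(F n)) \<subseteq> sets M" using F assms(2) by (auto intro!: sets.finite_Union)
    have "F m \<subseteq> F n" if "m \<le> n" for m n using that unfolding F_def by (intro image_mono) auto
    then show "incseq (\<lambda>n. \<Union>(F n))" unfolding incseq_def by (blast intro: Union_mono)
  qed
  moreover have "(SUP n. emeasure M (\<Union>(F n))) \<le> B"
    using F by (intro SUP_least fin)
  ultimately show ?thesis by simp
qed

lemma sum_set_nn_integral_disjoint_le:
  assumes "finite S" and disj: "disjoint_family_on E S" and [measurable]: "g \<in> borel_measurable M"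
    and E: "\<And>T. T \<in> S \<Longrightarrow> E T \<in> sets M" "\<And>T. T \<in> S \<Longrightarrow> E T \<subseteq> \<Omega>"
  shows "(\<Sum>T\<in>S. \<integral>\<^sup>+x\<in>E T. g x \<partial>M) \<le> (\<integral>\<^sup>+x\<in>\<Omega>. g x \<partial>M)"
proof -
  have "(\<Sum>T\<in>S. \<integral>\<^sup>+x\<in>E T. g x \<partial>M) = (\<integral>\<^sup>+x. (\<Sum>T\<in>S. g x * indicator (E T) x) \<partial>M)"
    using E by (intro nn_integral_sum[symmetric]) auto
  also have "\<dots> \<le> (\<integral>\<^sup>+x\<in>\<Omega>. g x \<partial>M)"
  proof (intro nn_integral_mono)
    fix x
    show "(\<Sum>T\<in>S. g x * indicator (E T) x) \<le> g x * indicator \<Omega> x"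
    proof (cases "\<exists>T\<in>S. x \<in> E T")
      case True
      then obtain T where T: "T \<in> S" "x \<in> E T" by blast
      have "(\<Sum>T'\<in>S. g x * indicator (E T') x) = (\<Sum>T'\<in>S. if T' = T then g x else 0)"
        using T disj by (intro sum.cong) (auto simp: indicator_def disjoint_family_on_def)
      also have "\<dots> = g x" using T \<open>finite S\<close> by simp
      finally have "(\<Sum>T'\<in>S. g x * indicator (E T') x) = g x" .
      moreover have "x \<in> \<Omega>" using T E(2) by blast
      ultimately show ?thesis by simp
    next
      case False
      then have "(\<Sum>T\<in>S. g x * indicator (E T) x) = 0"
        by (intro sum.neutral) (auto simp: indicator_def)
      then show ?thesis by simp
    qed
  qed
  finally show ?thesis .
qed

section \<open>Averages and maximal operators of set families\<close>

definition avg :: "'a::euclidean_space set \<Rightarrow> ('a \<Rightarrow> ennreal) \<Rightarrow> ennreal" where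
  "avg A g = (\<integral>\<^sup>+y\<in>A. g y \<partial>lborel) / emeasure lborel A"

text \<open>Restricting the supremum to the sets containing x makes every superlevel set a union of
  members of the family: measurable for countable Borel families, and directly open to covering
  arguments.\<close>

definition maxop :: "'a::euclidean_space set set \<Rightarrow> ('a \<Rightarrow> ennreal) \<Rightarrow> 'a \<Rightarrow> ennreal" where
  "maxop \<B> g x = (SUP B\<in>{B\<in>\<B>. x \<in> B}. avg B g)"

lemma avg_le_maxop: "B \<in> \<B> \<Longrightarrow> x \<in> B \<Longrightarrow> avg B g \<le> maxop \<B> g x"
  unfolding maxop_def by (auto intro: SUP_upper)

lemma less_maxop_iff: "t < maxop \<B> g x \<longleftrightarrow> (\<exists>B\<in>\<B>. x \<in> B \<and> t < avg B g)"
  unfolding maxop_def by (auto simp: less_SUP_iff)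

lemma maxop_level_set: "{x. t < maxop \<B> g x} = \<Union>{B\<in>\<B>. t < avg B g}"
  by (auto simp: less_maxop_iff)

lemma avg_mono: "(\<And>x. x \<in> A \<Longrightarrow> f x \<le> g x) \<Longrightarrow> avg A f \<le> avg A g"
  unfolding avg_def
  by (intro divide_right_mono_ennreal nn_integral_mono) (auto simp: indicator_def)

lemma avg_mult_emeasure:
  assumes "0 < emeasure lborel A" "emeasure lborel A < \<infinity>"
  shows "avg A g * emeasure lborel A = (\<integral>\<^sup>+y\<in>A. g y \<partial>lborel)"
  using assms by (simp add: avg_def ennreal_divide_times)

lemma avg_cmult: "g \<in> borel_measurable borel \<Longrightarrow> A \<in> sets borel \<Longrightarrow> avg A (\<lambda>x. c * g x) = c * avg A g"
  unfolding avg_def by (simp add: mult.assoc nn_integral_cmult ennreal_times_divide)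

text \<open>Only an inequality: if A has measure 0 or infinity, the quotient c|A|/|A| degenerates to
  0.\<close>

lemma avg_add_const_le:
  assumes [measurable]: "g \<in> borel_measurable borel" "A \<in> sets borel"
  shows "avg A (\<lambda>x. g x + c) \<le> avg A g + c"
proof -
  have "(\<integral>\<^sup>+x\<in>A. (g x + c) \<partial>lborel) = (\<integral>\<^sup>+x\<in>A. g x \<partial>lborel) + c * emeasure lborel A"
    by (simp add: distrib_right nn_integral_add nn_integral_cmult)
  then have "avg A (\<lambda>x. g x + c) = avg A g + c * emeasure lborel A / emeasure lborel A"
    by (simp add: avg_def add_divide_distrib_ennreal)
  also have "c * emeasure lborel A / emeasure lborel A \<le> c"
    by (cases "emeasure lborel A = 0 \<or> emeasure lborel A = top")
       (auto simp: ennreal_mult_divide_eq top_unique ennreal_divide_top)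
  finally show ?thesis by (simp add: add_left_mono)
qed

lemma measurable_maxop:
  assumes "countable \<B>" "\<B> \<subseteq> sets borel"
  shows "maxop \<B> g \<in> borel_measurable borel"
proof (rule borel_measurableI_greater)
  fix t :: ennreal
  have "countable {B\<in>\<B>. t < avg B g}" "{B\<in>\<B>. t < avg B g} \<subseteq> sets borel" using assms by auto
  then have "\<Union>{B\<in>\<B>. t < avg B g} \<in> sets borel" by (rule sets.countable_Union)
  then show "{x \<in> space borel. t < maxop \<B> g x} \<in> sets borel"
    by (simp add: maxop_level_set)
qed

text \<open>With this cutoff the weak type bound at level \<open>t\<close> only involves the part of \<open>g\<close> above
  \<open>t/2\<close>, which amounts to interpolating with the trivial bound for bounded functions.\<close>

lemma avg_cutoff:
  assumes [measurable]: "g \<in> borel_measurable borel" "A \<in> sets borel" and t: "ennreal t < avg A g" "0 < t"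
  shows "ennreal (t / 2) < avg A (\<lambda>x. g x * of_bool (ennreal (t / 2) < g x))"
proof (rule ccontr)
  assume *: "\<not> ?thesis"
  have "ennreal t < avg A g" by fact
  also have "\<dots> \<le> avg A (\<lambda>x. g x * of_bool (ennreal (t / 2) < g x) + ennreal (t / 2))"
    by (rule avg_mono) (auto simp: of_bool_def not_less)
  also have "\<dots> \<le> avg A (\<lambda>x. g x * of_bool (ennreal (t / 2) < g x)) + ennreal (t / 2)"
    by (rule avg_add_const_le) auto
  also have "\<dots> \<le> ennreal (t / 2) + ennreal (t / 2)"
    using * by (intro add_right_mono) auto
  also have "\<dots> = ennreal t" using t by (simp flip: ennreal_plus)
  finally show False by simp
qed

section \<open>The one-dimensional and the iterated maximal function\<close>

text \<open>With rational endpoints the families of intervals and rectangles are countable, so all maximal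
  functions are Borel measurable; a closed rectangle is slightly enlarged to an open rational one.\<close>

definition intervals :: "real set set" where
  "intervals = {{a<..<b} | a b. a \<in> \<rat> \<and> b \<in> \<rat> \<and> a < b}"

lemma countable_intervals: "countable intervals"
proof -
  have "intervals \<subseteq> (\<lambda>(a, b). {a<..<b}) ` (\<rat> \<times> \<rat>)" unfolding intervals_def by auto
  then show ?thesis by (rule countable_subset) (simp add: countable_rat)
qed

lemma intervals_sets [measurable_dest]: "I \<in> intervals \<Longrightarrow> I \<in> sets borel"
  unfolding intervals_def by auto

lemma intervals_emeasure: "I \<in> intervals \<Longrightarrow> 0 < emeasure lborel I \<and> emeasure lborel I < \<infinity>"
  unfolding intervals_def by auto

text \<open>A selected interval that meets R and is at least as long has a triple containing R; the
  3 is the cost of tripling.\<close>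

lemma maxop_intervals_weak_type:
  assumes [measurable]: "g \<in> borel_measurable borel" and t: "0 < t"
  shows "emeasure lborel {x. ennreal t < maxop intervals g x} \<le> ennreal (3 / t) * (\<integral>\<^sup>+x. g x \<partial>lborel)"
  unfolding maxop_level_set
proof (rule emeasure_UN_le_if_finite)
  show "countable {B \<in> intervals. ennreal t < avg B g}"
    using countable_intervals by (rule countable_subset[rotated]) auto
  show "{B \<in> intervals. ennreal t < avg B g} \<subseteq> sets lborel"
    using intervals_sets by auto
next
  fix F assume F: "finite F" "F \<subseteq> {B \<in> intervals. ennreal t < avg B g}"
  obtain S where S: "S \<subseteq> F" "disjoint_family_on (\<lambda>B. B) S"
    "\<And>R. R \<in> F \<Longrightarrow> R \<noteq> {} \<Longrightarrow> \<exists>T\<in>S. R \<inter> T \<noteq> {} \<and> measure lborel R \<le> measure lborel T"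
    by (rule vitali_selection[OF F(1), of "\<lambda>B. B" "measure lborel"]) blast
  have "finite S" using S(1) F(1) finite_subset by blast
  \<comment> \<open>The concentric triple, with the endpoints of T recovered as its infimum and
    supremum.\<close>
  define N where "N T = {2 * Inf T - Sup T <..< 2 * Sup T - Inf T}" for T :: "real set"
  have N: "N {a<..<b} = {2 * a - b <..< 2 * b - a}" if "a < b" for a b
    using that unfolding N_def by simp
  have Nm: "emeasure lborel (N T) = 3 * emeasure lborel T" if "T \<in> intervals" for T
  proof -
    from that obtain a b where T: "T = {a<..<b}" "a < b" unfolding intervals_def by auto
    have "ennreal (3 * (b - a)) = 3 * ennreal (b - a)" using T by (subst ennreal_mult) auto
    then show ?thesis using T by (simp add: N algebra_simps)
  qed
  have "\<Union>F \<subseteq> (\<Union>T\<in>S. N T)"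
  proof
    fix x assume "x \<in> \<Union>F"
    then obtain R where R: "x \<in> R" "R \<in> F" by auto
    then obtain T where T: "T \<in> S" "R \<inter> T \<noteq> {}" "measure lborel R \<le> measure lborel T"
      using S(3) by blast
    obtain a b where ab: "R = {a<..<b}" "a < b" using R F unfolding intervals_def by auto
    obtain c d where cd: "T = {c<..<d}" "c < d" using T(1) S(1) F unfolding intervals_def by blast
    have "a < d" "c < b" "b - a \<le> d - c" using T ab cd by auto
    then have "x \<in> N T" using R ab cd by (auto simp: N)
    then show "x \<in> (\<Union>T\<in>S. N T)" using T(1) by blast
  qed
  then have "emeasure lborel (\<Union>F) \<le> emeasure lborel (\<Union>T\<in>S. N T)"
    using \<open>finite S\<close> by (intro emeasure_mono) (auto simp: N_def)
  also have "\<dots> \<le> (\<Sum>T\<in>S. emeasure lborel (N T))"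
    using \<open>finite S\<close> by (intro emeasure_subadditive_finite) (auto simp: N_def)
  also have "\<dots> \<le> (\<Sum>T\<in>S. ennreal (3 / t) * (\<integral>\<^sup>+x\<in>T. g x \<partial>lborel))"
  proof (rule sum_mono)
    fix T assume "T \<in> S"
    then have T: "T \<in> intervals" "ennreal t < avg T g" using S(1) F(2) by auto
    have "emeasure lborel (N T) = ennreal (3 / t) * (ennreal t * emeasure lborel T)"
    proof -
      have "ennreal (3 / t) * ennreal t = 3" using t by (simp flip: ennreal_mult)
      then show ?thesis by (simp add: Nm[OF T(1)] mult.assoc[symmetric])
    qed
    also have "ennreal t * emeasure lborel T \<le> avg T g * emeasure lborel T"
      using T by (intro mult_right_mono) auto
    also have "\<dots> = (\<integral>\<^sup>+x\<in>T. g x \<partial>lborel)"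
      using intervals_emeasure[OF T(1)] by (intro avg_mult_emeasure) auto
    finally show "emeasure lborel (N T) \<le> ennreal (3 / t) * (\<integral>\<^sup>+x\<in>T. g x \<partial>lborel)"
      by (simp add: mult_left_mono)
  qed
  also have "\<dots> = ennreal (3 / t) * (\<Sum>T\<in>S. \<integral>\<^sup>+x\<in>T. g x \<partial>lborel)"
    by (simp add: sum_distrib_left)
  also have "(\<Sum>T\<in>S. \<integral>\<^sup>+x\<in>T. g x \<partial>lborel) \<le> (\<integral>\<^sup>+x\<in>UNIV. g x \<partial>lborel)"
    using \<open>finite S\<close> S(1,2) F(2) intervals_sets
    by (intro sum_set_nn_integral_disjoint_le) auto
  finally show "emeasure lborel (\<Union>F) \<le> ennreal (3 / t) * (\<integral>\<^sup>+x. g x \<partial>lborel)"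
    by (simp add: mult_left_mono)
qed

lemma maxop_intervals_strong_type:
  assumes "1 < p"
  obtains C :: real where "0 < C" "\<And>g. g \<in> borel_measurable borel \<Longrightarrow>
    (\<integral>\<^sup>+x. ennreal_powr (maxop intervals g x) p \<partial>lborel) \<le> ennreal C * (\<integral>\<^sup>+x. ennreal_powr (g x) p \<partial>lborel)"
proof
  \<comment> \<open>The interpolation constant for q = 1. The further factor 6 = 3 * 2 is the weak
    type constant 3 applied at level t/2.\<close>
  let ?D = "2 powr (2 * p - 1) / (1 - 2 powr (1 - p))"
  have "2 powr (1 - p) < (1::real)" using assms by (simp add: powr_less_one)
  then have D: "0 < ?D" by simp
  then show "0 < ?D * 6" by (rule mult_pos_pos) simp
  fix g :: "real \<Rightarrow> ennreal" assume [measurable]: "g \<in> borel_measurable borel"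
  have [measurable]: "maxop intervals g \<in> borel_measurable borel"
    using countable_intervals intervals_sets by (intro measurable_maxop) auto
  have "(\<integral>\<^sup>+x. ennreal_powr (maxop intervals g x) p \<partial>lborel) \<le>
      ennreal ?D * (6 * (\<integral>\<^sup>+x. ennreal_powr (g x) p \<partial>lborel))"
  proof (rule marcinkiewicz_dyadic)
    fix t :: real assume t: "0 < t"
    let ?h = "\<lambda>x. g x * of_bool (ennreal (t / 2) < g x)"
    have "emeasure lborel {x. ennreal t < maxop intervals g x} \<le>
        emeasure lborel {x. ennreal (t / 2) < maxop intervals ?h x}"
      unfolding maxop_level_set
    proof (rule emeasure_mono)
      show "\<Union>{B \<in> intervals. ennreal t < avg B g} \<subseteq> \<Union>{B \<in> intervals. ennreal (t / 2) < avg B ?h}"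
      proof
        fix x assume "x \<in> \<Union>{B \<in> intervals. ennreal t < avg B g}"
        then obtain B where B: "x \<in> B" "B \<in> intervals" "ennreal t < avg B g" by auto
        then have "ennreal (t / 2) < avg B ?h" using t intervals_sets by (intro avg_cutoff) auto
        then show "x \<in> \<Union>{B \<in> intervals. ennreal (t / 2) < avg B ?h}" using B by blast
      qed
      show "\<Union>{B \<in> intervals. ennreal (t / 2) < avg B ?h} \<in> sets lborel"
        using intervals_sets countable_subset[OF _ countable_intervals]
        by (intro sets.countable_Union) auto
    qed
    also have "\<dots> \<le> ennreal (3 / (t / 2)) * (\<integral>\<^sup>+x. ?h x \<partial>lborel)"
      using t by (intro maxop_intervals_weak_type) auto
    also have "ennreal (3 / (t / 2)) = ennreal (t powr - 1) * 6"
      using t by (simp add: powr_minus divide_simps ennreal_mult'[symmetric] flip: ennreal_numeral)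
    finally show "emeasure lborel {x \<in> space lborel. ennreal t < maxop intervals g x} \<le>
      ennreal (t powr - 1) * (6 * (\<integral>\<^sup>+x. ennreal_powr (g x) 1 * of_bool (ennreal (t / 2) < g x) \<partial>lborel))"
      by (simp add: mult.assoc)
  qed (use assms in auto)
  then show "(\<integral>\<^sup>+x. ennreal_powr (maxop intervals g x) p \<partial>lborel) \<le>
      ennreal (?D * 6) * (\<integral>\<^sup>+x. ennreal_powr (g x) p \<partial>lborel)"
    using D by (subst ennreal_mult) (auto simp: mult.assoc)
qed

section \<open>Rational rectangles and iterated averages\<close>

definition rectangles :: "(real \<times> real) set set" where
  "rectangles = {I \<times> J | I J. I \<in> intervals \<and> J \<in> intervals}"

lemma countable_rectangles: "countable rectangles"
proof -
  have "rectangles = (\<lambda>(I, J). I \<times> J) ` (intervals \<times> intervals)"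
    unfolding rectangles_def by auto
  then show ?thesis by (metis countable_SIGMA countable_image countable_intervals)
qed

lemma emeasure_lborel_Times:
  fixes A B :: "real set"
  assumes "A \<in> sets borel" "B \<in> sets borel"
  shows "emeasure lborel (A \<times> B) = emeasure lborel A * emeasure lborel B"
  using assms by (simp add: lborel.emeasure_pair_measure_Times flip: lborel_prod)

lemma rectangles_sets: "R \<in> rectangles \<Longrightarrow> R \<in> sets borel"
  unfolding rectangles_def using intervals_sets by (auto intro: borel_Times)

lemma rectangles_emeasure: "R \<in> rectangles \<Longrightarrow> 0 < emeasure lborel R \<and> emeasure lborel R < \<infinity>"
  unfolding rectangles_def using intervals_emeasure intervals_sets
  by (auto simp: emeasure_lborel_Times ennreal_zero_less_mult_iff ennreal_mult_less_top)

lemma measurable_avg_section: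
  assumes g: "g \<in> borel_measurable (borel \<Otimes>\<^sub>M borel)" and [measurable]: "B \<in> sets borel"
  shows "(\<lambda>y. avg B (\<lambda>x. g (x, y))) \<in> borel_measurable borel"
    and "(\<lambda>x. avg B (\<lambda>y. g (x, y))) \<in> borel_measurable borel"
proof -
  note [measurable] = g
  have "(\<lambda>(y, x). g (x, y) * indicator B x) \<in> borel_measurable (borel \<Otimes>\<^sub>M lborel)"
    "(\<lambda>(x, y). g (x, y) * indicator B y) \<in> borel_measurable (borel \<Otimes>\<^sub>M lborel)"
    by measurable
  from this[THEN lborel.borel_measurable_nn_integral]
  show "(\<lambda>y. avg B (\<lambda>x. g (x, y))) \<in> borel_measurable borel"
    "(\<lambda>x. avg B (\<lambda>y. g (x, y))) \<in> borel_measurable borel"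
    unfolding avg_def by simp_all
qed

text \<open>Joint measurability, as Tonelli requires: the superlevel set is a countable union over
  rational B, each piece restricting one coordinate to B and the other by the size of the
  average.\<close>

lemma measurable_maxop_section:
  assumes g: "g \<in> borel_measurable (borel \<Otimes>\<^sub>M borel)"
  shows "(\<lambda>z. maxop intervals (\<lambda>x. g (x, snd z)) (fst z)) \<in> borel_measurable (borel \<Otimes>\<^sub>M borel)"
    and "(\<lambda>z. maxop intervals (\<lambda>y. g (fst z, y)) (snd z)) \<in> borel_measurable (borel \<Otimes>\<^sub>M borel)"
proof -
  note [measurable] = measurable_avg_section[OF g]
  have "(\<Union>B\<in>intervals. {z\<in>space (borel \<Otimes>\<^sub>M borel). fst z \<in> B \<and> t < avg B (\<lambda>x. g (x, snd z))}) \<in> sets (borel \<Otimes>\<^sub>M borel)"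
    "(\<Union>B\<in>intervals. {z\<in>space (borel \<Otimes>\<^sub>M borel). snd z \<in> B \<and> t < avg B (\<lambda>y. g (fst z, y))}) \<in> sets (borel \<Otimes>\<^sub>M borel)"
    for t
    using countable_intervals by (auto intro!: sets.countable_UN')
  moreover have
    "{z\<in>space (borel \<Otimes>\<^sub>M borel). t < maxop intervals (\<lambda>x. g (x, snd z)) (fst z)} =
      (\<Union>B\<in>intervals. {z\<in>space (borel \<Otimes>\<^sub>M borel). fst z \<in> B \<and> t < avg B (\<lambda>x. g (x, snd z))})"
    "{z\<in>space (borel \<Otimes>\<^sub>M borel). t < maxop intervals (\<lambda>y. g (fst z, y)) (snd z)} =
      (\<Union>B\<in>intervals. {z\<in>space (borel \<Otimes>\<^sub>M borel). snd z \<in> B \<and> t < avg B (\<lambda>y. g (fst z, y))})" for t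
    by (auto simp: less_maxop_iff)
  ultimately show "(\<lambda>z. maxop intervals (\<lambda>x. g (x, snd z)) (fst z)) \<in> borel_measurable (borel \<Otimes>\<^sub>M borel)"
    "(\<lambda>z. maxop intervals (\<lambda>y. g (fst z, y)) (snd z)) \<in> borel_measurable (borel \<Otimes>\<^sub>M borel)"
    by (auto intro!: borel_measurableI_greater)
qed

lemma avg_Times:
  fixes I J :: "real set"
  assumes g [measurable]: "g \<in> borel_measurable (borel \<Otimes>\<^sub>M borel)"
    and [measurable]: "I \<in> sets borel" "J \<in> sets borel"
    and I: "0 < emeasure lborel I" "emeasure lborel I < \<infinity>"
  shows "avg (I \<times> J) g = avg J (\<lambda>y. avg I (\<lambda>x. g (x, y)))"
proof -
  have ind: "indicator (I \<times> J) (x, y) = (indicator I x * indicator J y :: ennreal)" for x y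
    by (auto simp: indicator_def)
  have [measurable]: "(\<lambda>y. \<integral>\<^sup>+x\<in>I. g (x, y) \<partial>lborel) \<in> borel_measurable borel"
    by measurable
  have "(\<integral>\<^sup>+z\<in>I \<times> J. g z \<partial>lborel) = (\<integral>\<^sup>+z. g z * indicator (I \<times> J) z \<partial>(lborel \<Otimes>\<^sub>M lborel))"
    by (simp add: lborel_prod)
  also have "\<dots> = (\<integral>\<^sup>+y. (\<integral>\<^sup>+x. g (x, y) * indicator (I \<times> J) (x, y) \<partial>lborel) \<partial>lborel)"
    by (rule lborel_pair.nn_integral_snd[symmetric]) measurable
  also have "\<dots> = (\<integral>\<^sup>+y\<in>J. (\<integral>\<^sup>+x\<in>I. g (x, y) \<partial>lborel) \<partial>lborel)"
    by (intro nn_integral_cong) (simp add: ind nn_integral_multc flip: mult.assoc)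
  finally have *: "(\<integral>\<^sup>+z\<in>I \<times> J. g z \<partial>lborel) = (\<integral>\<^sup>+y\<in>J. (\<integral>\<^sup>+x\<in>I. g (x, y) \<partial>lborel) \<partial>lborel)" .
  have "avg J (\<lambda>y. avg I (\<lambda>x. g (x, y))) =
      (\<integral>\<^sup>+y\<in>J. (\<integral>\<^sup>+x\<in>I. g (x, y) \<partial>lborel) \<partial>lborel) / emeasure lborel I / emeasure lborel J"
    by (subst nn_integral_divide[symmetric])
       (auto simp: avg_def divide_ennreal_def mult_ac intro!: arg_cong[of _ _ "\<lambda>x. x * _"] nn_integral_cong)
  \<comment> \<open>The inverse of |I| |J| splits into a product because |I| is neither 0 nor
    infinite.\<close>
  also have "\<dots> = (\<integral>\<^sup>+z\<in>I \<times> J. g z \<partial>lborel) / (emeasure lborel I * emeasure lborel J)"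
    using I by (simp add: * divide_ennreal_def mult.assoc ennreal_inverse_mult')
  finally show ?thesis by (simp add: avg_def emeasure_lborel_Times)
qed

text \<open>The argument of Jessen, Marcinkiewicz and Zygmund: an average over I \<times> J is an
  average in x followed by one in y, so it lies below the iterate of the two one-dimensional maximal
  functions. Each variable contributes a factor C. Later arguments use only the majorant property of
  \<open>G\<close> and its norm.\<close>

lemma rectangles_majorant:
  assumes "1 < p"
  obtains C :: real where "0 < C" "\<And>g. g \<in> borel_measurable borel \<Longrightarrow>
    \<exists>G. G \<in> borel_measurable borel \<and> (\<forall>R\<in>rectangles. \<forall>z\<in>R. avg R g \<le> G z) \<and>
      (\<integral>\<^sup>+z. ennreal_powr (G z) p \<partial>lborel) \<le> ennreal C * (\<integral>\<^sup>+z. ennreal_powr (g z) p \<partial>lborel)"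
proof -
  obtain C where C: "0 < C" "\<And>g. g \<in> borel_measurable borel \<Longrightarrow>
    (\<integral>\<^sup>+x. ennreal_powr (maxop intervals g x) p \<partial>lborel) \<le> ennreal C * (\<integral>\<^sup>+x. ennreal_powr (g x) p \<partial>lborel)"
    using maxop_intervals_strong_type[OF assms] by blast
  have "\<exists>G. G \<in> borel_measurable borel \<and> (\<forall>R\<in>rectangles. \<forall>z\<in>R. avg R g \<le> G z) \<and>
      (\<integral>\<^sup>+z. ennreal_powr (G z) p \<partial>lborel) \<le> ennreal (C * C) * (\<integral>\<^sup>+z. ennreal_powr (g z) p \<partial>lborel)"
    if g': "g \<in> borel_measurable borel" for g :: "real \<times> real \<Rightarrow> ennreal"
  proof -
    have g [measurable]: "g \<in> borel_measurable (borel \<Otimes>\<^sub>M borel)" using g' by (simp add: borel_prod)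
    define h where "h z = maxop intervals (\<lambda>x. g (x, snd z)) (fst z)" for z
    have h [measurable]: "h \<in> borel_measurable (borel \<Otimes>\<^sub>M borel)"
      using measurable_maxop_section(1)[OF g] unfolding h_def .
    define G where "G z = maxop intervals (\<lambda>y. h (fst z, y)) (snd z)" for z
    have G [measurable]: "G \<in> borel_measurable (borel \<Otimes>\<^sub>M borel)"
      using measurable_maxop_section(2)[OF h] unfolding G_def .
    have "avg R g \<le> G z" if Rz: "R \<in> rectangles" "z \<in> R" for R z
    proof -
      obtain I J x y where R: "R = I \<times> J" "I \<in> intervals" "J \<in> intervals" and z: "z = (x, y)" "x \<in> I" "y \<in> J"
        using Rz unfolding rectangles_def by (cases z) auto
      have "avg R g = avg J (\<lambda>y. avg I (\<lambda>x. g (x, y)))"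
        unfolding R(1) using R intervals_sets intervals_emeasure by (intro avg_Times) auto
      also have "\<dots> \<le> avg J (\<lambda>y. h (x, y))"
        using R z by (intro avg_mono) (auto simp: h_def intro: avg_le_maxop)
      also have "\<dots> \<le> G z" using R z by (auto simp: G_def intro: avg_le_maxop)
      finally show ?thesis .
    qed
    moreover have "(\<integral>\<^sup>+z. ennreal_powr (G z) p \<partial>lborel) \<le>
        ennreal (C * C) * (\<integral>\<^sup>+z. ennreal_powr (g z) p \<partial>lborel)"
    proof -
      have "(\<integral>\<^sup>+z. ennreal_powr (G z) p \<partial>(lborel \<Otimes>\<^sub>M lborel)) =
          (\<integral>\<^sup>+x. \<integral>\<^sup>+y. ennreal_powr (maxop intervals (\<lambda>y. h (x, y)) y) p \<partial>lborel \<partial>lborel)"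
        by (subst lborel.nn_integral_fst[symmetric]) (auto simp: G_def[symmetric, of "(_, _)", simplified])
      also have "\<dots> \<le> (\<integral>\<^sup>+x. ennreal C * (\<integral>\<^sup>+y. ennreal_powr (h (x, y)) p \<partial>lborel) \<partial>lborel)"
        by (intro nn_integral_mono C(2)) measurable
      also have "\<dots> = ennreal C * (\<integral>\<^sup>+x. \<integral>\<^sup>+y. ennreal_powr (h (x, y)) p \<partial>lborel \<partial>lborel)"
        by (rule nn_integral_cmult) measurable
      \<comment> \<open>The order is exchanged because \<open>h\<close> is a maximal function in x,
        whereas \<open>G\<close> is one in y.\<close>
      also have "(\<integral>\<^sup>+x. \<integral>\<^sup>+y. ennreal_powr (h (x, y)) p \<partial>lborel \<partial>lborel) =
          (\<integral>\<^sup>+y. \<integral>\<^sup>+x. ennreal_powr (h (x, y)) p \<partial>lborel \<partial>lborel)"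
        by (rule lborel_pair.Fubini'[symmetric]) measurable
      also have "\<dots> = (\<integral>\<^sup>+y. \<integral>\<^sup>+x. ennreal_powr (maxop intervals (\<lambda>x. g (x, y)) x) p \<partial>lborel \<partial>lborel)"
        by (simp add: h_def)
      also have "\<dots> \<le> (\<integral>\<^sup>+y. ennreal C * (\<integral>\<^sup>+x. ennreal_powr (g (x, y)) p \<partial>lborel) \<partial>lborel)"
        by (intro nn_integral_mono C(2)) measurable
      also have "\<dots> = ennreal C * (\<integral>\<^sup>+y. \<integral>\<^sup>+x. ennreal_powr (g (x, y)) p \<partial>lborel \<partial>lborel)"
        by (rule nn_integral_cmult) measurable
      also have "(\<integral>\<^sup>+y. \<integral>\<^sup>+x. ennreal_powr (g (x, y)) p \<partial>lborel \<partial>lborel) =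
          (\<integral>\<^sup>+z. ennreal_powr (g z) p \<partial>(lborel \<Otimes>\<^sub>M lborel))"
        by (rule lborel_pair.nn_integral_snd) measurable
      finally show ?thesis
        using C(1) by (simp add: lborel_prod ennreal_mult mult.assoc mult_left_mono)
    qed
    ultimately show ?thesis using G by (intro exI[of _ G]) (simp add: borel_prod)
  qed
  then show ?thesis using that[of "C * C"] C(1) by simp
qed

section \<open>Weak type bound for wide rectangles\<close>

text \<open>The open rectangle with lower left corner \<open>(a, c)\<close>, width \<open>h\<close> and height \<open>k\<close>.\<close>

definition rect :: "real \<times> real \<times> real \<times> real \<Rightarrow> (real \<times> real) set" where
  "rect = (\<lambda>(a, c, h, k). {a<..<a + h} \<times> {c<..<c + k})"

text \<open>Given as an image of quadruples so that selections can run on the parameters, ranked by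
  the width in the third entry.\<close>

definition wide_rectangles :: "(real \<times> real) set set" where
  "wide_rectangles = rect ` {(a, c, h, k). a \<in> \<rat> \<and> c \<in> \<rat> \<and> h \<in> \<rat> \<and> k \<in> \<rat> \<and> 0 < k \<and> k \<le> h}"

definition axis_squares :: "(real \<times> real) set set" where
  "axis_squares = rect ` {(a, c, h, k). a \<in> \<rat> \<and> c \<in> \<rat> \<and> h \<in> \<rat> \<and> 0 < h \<and> k = h}"

lemma rect_sets [measurable]: "rect R \<in> sets borel"
  unfolding rect_def by (auto split: prod.split intro!: borel_Times)

lemma emeasure_rect: "0 < h \<Longrightarrow> 0 < k \<Longrightarrow> emeasure lborel (rect (a, c, h, k)) = ennreal (h * k)"
  by (simp add: rect_def emeasure_lborel_Times ennreal_mult)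

lemma rect_in_rectangles:
  "a \<in> \<rat> \<Longrightarrow> c \<in> \<rat> \<Longrightarrow> h \<in> \<rat> \<Longrightarrow> k \<in> \<rat> \<Longrightarrow> 0 < h \<Longrightarrow> 0 < k \<Longrightarrow> rect (a, c, h, k) \<in> rectangles"
proof -
  assume "a \<in> \<rat>" "c \<in> \<rat>" "h \<in> \<rat>" "k \<in> \<rat>" "0 < h" "0 < k"
  then have "{a<..<a + h} \<in> intervals" "{c<..<c + k} \<in> intervals"
    unfolding intervals_def by (blast intro: Rats_add less_add_same_cancel1[THEN iffD2])+
  then show ?thesis unfolding rectangles_def rect_def by blast
qed

lemma wide_rectangles_subset: "wide_rectangles \<subseteq> rectangles"
  unfolding wide_rectangles_def by (auto intro!: rect_in_rectangles)

lemma axis_squares_subset: "axis_squares \<subseteq> rectangles"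
  unfolding axis_squares_def by (auto intro!: rect_in_rectangles)

text \<open>A Fefferman-Stein estimate. For a selected square T with triple N, w(N) equals 9|T|
  times the average of \<open>w\<close> over N, hence is at most 18 |T \<inter> \<Omega>| times that
  average because T is half covered. As T lies in N, \<open>u\<close> is at least this average on T
  \<inter> \<Omega>, and these pieces are disjoint.\<close>

lemma emeasure_density_square_cover:
  assumes [measurable]: "w \<in> borel_measurable borel" "u \<in> borel_measurable borel" "\<Omega> \<in> sets borel"
    and u: "\<And>Q x. Q \<in> axis_squares \<Longrightarrow> x \<in> Q \<Longrightarrow> avg Q w \<le> u x"
  shows "emeasure (density lborel w) (\<Union>{Q\<in>axis_squares. emeasure lborel Q \<le> 2 * emeasure lborel (Q \<inter> \<Omega>)})
    \<le> 18 * (\<integral>\<^sup>+x\<in>\<Omega>. u x \<partial>lborel)"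
proof (rule emeasure_UN_le_if_finite)
  show "countable {Q\<in>axis_squares. emeasure lborel Q \<le> 2 * emeasure lborel (Q \<inter> \<Omega>)}"
    using axis_squares_subset by (intro countable_subset[OF _ countable_rectangles]) auto
  show "{Q\<in>axis_squares. emeasure lborel Q \<le> 2 * emeasure lborel (Q \<inter> \<Omega>)} \<subseteq> sets (density lborel w)"
    using axis_squares_subset rectangles_sets by auto
next
  fix F assume F: "finite F" "F \<subseteq> {Q\<in>axis_squares. emeasure lborel Q \<le> 2 * emeasure lborel (Q \<inter> \<Omega>)}"
  let ?I = "{(a, c, h, k). a \<in> \<rat> \<and> c \<in> \<rat> \<and> h \<in> \<rat> \<and> 0 < h \<and> k = h} :: (real \<times> real \<times> real \<times> real) set"
  have "F \<subseteq> rect ` ?I" using F(2) unfolding axis_squares_def by auto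
  then obtain F' where F': "F' \<subseteq> ?I" "finite F'" "F = rect ` F'"
    using finite_subset_image[OF F(1) \<open>F \<subseteq> rect ` ?I\<close>] by auto
  obtain S where S: "S \<subseteq> F'" "disjoint_family_on rect S"
    "\<And>R. R \<in> F' \<Longrightarrow> rect R \<noteq> {} \<Longrightarrow> \<exists>T\<in>S. rect R \<inter> rect T \<noteq> {} \<and> (case R of (a, c, h, k) \<Rightarrow> h) \<le> (case T of (a, c, h, k) \<Rightarrow> h)"
    by (rule vitali_selection[OF F'(2), of rect "\<lambda>(a, c, h, k). h"]) blast
  have "finite S" using S(1) F'(2) finite_subset by blast
  define N where "N = (\<lambda>(a, c, h, k :: real). rect (a - h, c - h, 3 * h, 3 * h))"
  have [measurable]: "N T \<in> sets borel" for T unfolding N_def by (auto split: prod.split)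
  have "\<Union>F \<subseteq> (\<Union>T\<in>S. N T)"
  proof
    fix x assume "x \<in> \<Union>F"
    then obtain R where R: "R \<in> F'" "x \<in> rect R" using F'(3) by blast
    then obtain T where T: "T \<in> S" "rect R \<inter> rect T \<noteq> {}" "(case R of (a, c, h, k) \<Rightarrow> h) \<le> (case T of (a, c, h, k) \<Rightarrow> h)"
      using S(3) by blast
    obtain a c h where R': "R = (a, c, h, h)" using R F'(1) by auto
    obtain a' c' h' where T': "T = (a', c', h', h')" using T S(1) F'(1) by blast
    have "x \<in> N T" using R(2) T unfolding R' T' N_def rect_def by auto
    then show "x \<in> (\<Union>T\<in>S. N T)" using T(1) by blast
  qed
  then have "emeasure (density lborel w) (\<Union>F) \<le> emeasure (density lborel w) (\<Union>T\<in>S. N T)"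
    using \<open>finite S\<close> by (intro emeasure_mono) auto
  also have "\<dots> \<le> (\<Sum>T\<in>S. emeasure (density lborel w) (N T))"
    using \<open>finite S\<close> by (intro emeasure_subadditive_finite) auto
  also have "\<dots> \<le> (\<Sum>T\<in>S. 18 * (\<integral>\<^sup>+x\<in>rect T \<inter> \<Omega>. u x \<partial>lborel))"
  proof (rule sum_mono)
    fix T assume T: "T \<in> S"
    then obtain a c h where T': "T = (a, c, h, h)" and rat: "a \<in> \<rat>" "c \<in> \<rat>" "h \<in> \<rat>" "0 < h"
      using S(1) F'(1) by blast
    have NT: "N T = rect (a - h, c - h, 3 * h, 3 * h)" unfolding T' N_def by simp
    have N_in: "N T \<in> axis_squares"
      unfolding NT axis_squares_def using rat by (intro imageI) auto
    have half: "emeasure lborel (rect T) \<le> 2 * emeasure lborel (rect T \<inter> \<Omega>)"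
      using T S(1) F'(3) F(2) by blast
    have "rect T \<subseteq> N T" unfolding NT unfolding T' rect_def using rat by auto
    have vol: "emeasure lborel (N T) = 9 * emeasure lborel (rect T)"
    proof -
      have "ennreal ((3 * h) * (3 * h)) = ennreal (9 * (h * h))" by (simp add: algebra_simps)
      also have "\<dots> = 9 * ennreal (h * h)" using rat by (subst ennreal_mult) auto
      finally show ?thesis unfolding NT unfolding T' using rat by (simp add: emeasure_rect)
    qed
    have "emeasure (density lborel w) (N T) = avg (N T) w * emeasure lborel (N T)"
      using rectangles_emeasure[of "N T"] N_in axis_squares_subset
      by (subst avg_mult_emeasure) (auto simp: emeasure_density)
    also have "\<dots> \<le> avg (N T) w * (9 * (2 * emeasure lborel (rect T \<inter> \<Omega>)))"
      unfolding vol by (intro mult_left_mono half) auto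
    also have "\<dots> = 18 * (avg (N T) w * emeasure lborel (rect T \<inter> \<Omega>))"
      by (simp add: mult.left_commute[of "avg _ _"] mult.assoc[symmetric, of 9 2] mult.assoc[symmetric, of 2 9])
    also have "avg (N T) w * emeasure lborel (rect T \<inter> \<Omega>) = (\<integral>\<^sup>+x\<in>rect T \<inter> \<Omega>. avg (N T) w \<partial>lborel)"
      by (subst nn_integral_cmult_indicator) auto
    also have "\<dots> \<le> (\<integral>\<^sup>+x\<in>rect T \<inter> \<Omega>. u x \<partial>lborel)"
      using u[OF N_in] \<open>rect T \<subseteq> N T\<close> by (intro nn_integral_mono) (auto simp: indicator_def)
    finally show "emeasure (density lborel w) (N T) \<le> 18 * (\<integral>\<^sup>+x\<in>rect T \<inter> \<Omega>. u x \<partial>lborel)"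
      by (simp add: mult_left_mono)
  qed
  also have "\<dots> = 18 * (\<Sum>T\<in>S. \<integral>\<^sup>+x\<in>rect T \<inter> \<Omega>. u x \<partial>lborel)"
    by (simp add: sum_distrib_left)
  also have "(\<Sum>T\<in>S. \<integral>\<^sup>+x\<in>rect T \<inter> \<Omega>. u x \<partial>lborel) \<le> (\<integral>\<^sup>+x\<in>\<Omega>. u x \<partial>lborel)"
  proof (intro sum_set_nn_integral_disjoint_le)
    show "disjoint_family_on (\<lambda>T. rect T \<inter> \<Omega>) S"
      using S(2) unfolding disjoint_family_on_def by blast
  qed (use \<open>finite S\<close> in auto)
  finally show "emeasure (density lborel w) (\<Union>F) \<le> 18 * (\<integral>\<^sup>+x\<in>\<Omega>. u x \<partial>lborel)"
    by (simp add: mult_left_mono)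
qed

section \<open>From half-covered rectangles to half-covered squares\<close>

definition widened :: "real \<times> real \<times> real \<times> real \<Rightarrow> (real \<times> real) set" where
  "widened = (\<lambda>(a, c, h, k). rect (a - h, c, 3 * h, k))"

lemma rect_subset_widened: "rect (a, c, h, k) \<subseteq> widened (a, c, h, k)"
  unfolding widened_def rect_def by (cases "0 < h") auto

text \<open>If T meets R and is at least as wide, \<open>widened T\<close> spans the whole base of
  R. The heights of all such T therefore form one set \<open>G\<close> covered over every point of
  the base, and base \<times> G contains the covered part of R. Dividing the area inequality by the
  width gives k \<le> 2|G|. If R itself is selected, G is its full vertical side.\<close>

lemma wide_rectangle_half_fibre:
  assumes S: "finite S" and R: "0 < h" "0 < k"
    and half: "(a, c, h, k) \<notin> S \<Longrightarrow> emeasure lborel (rect (a, c, h, k)) \<le> 2 * emeasure lborel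
      (rect (a, c, h, k) \<inter> (\<Union>T\<in>{T\<in>S. h \<le> (case T of (a, c, h, k) \<Rightarrow> h)}. rect T))"
  obtains G where "G \<in> sets borel" "G \<subseteq> {c<..<c + k}" "ennreal k \<le> 2 * emeasure lborel G"
    "{a<..<a + h} \<times> G \<subseteq> (\<Union>T\<in>S. widened T)"
proof (cases "(a, c, h, k) \<in> S")
  case True
  have "{a<..<a + h} \<times> {c<..<c + k} \<subseteq> (\<Union>T\<in>S. widened T)"
    using rect_subset_widened[of a c h k] True unfolding rect_def by force
  moreover have "ennreal k \<le> 2 * emeasure lborel {c<..<c + k}"
    using R by (simp add: mult_2)
  ultimately show ?thesis using that[of "{c<..<c + k}"] by auto
next
  case False
  \<comment> \<open>A T disjoint from R may share heights with R while its triple stays away from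
    the base of R, so it is left out.\<close>
  define S' where "S' = {T\<in>S. h \<le> (case T of (a, c, h, k) \<Rightarrow> h) \<and> rect (a, c, h, k) \<inter> rect T \<noteq> {}}"
  define G where "G = {c<..<c + k} \<inter> (\<Union>(a', c', h', k')\<in>S'. {c'<..<c' + k'})"
  have "finite S'" using S unfolding S'_def by auto
  then have [measurable]: "G \<in> sets borel" unfolding G_def
    by (intro sets.Int sets.finite_UN) (auto split: prod.split)
  have sub: "rect (a, c, h, k) \<inter> (\<Union>T\<in>{T\<in>S. h \<le> (case T of (a, c, h, k) \<Rightarrow> h)}. rect T) \<subseteq> {a<..<a + h} \<times> G"
  proof
    fix z assume z: "z \<in> rect (a, c, h, k) \<inter> (\<Union>T\<in>{T\<in>S. h \<le> (case T of (a, c, h, k) \<Rightarrow> h)}. rect T)"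
    then obtain T where T: "T \<in> S" "h \<le> (case T of (a, c, h, k) \<Rightarrow> h)" "z \<in> rect T" by auto
    obtain a' c' h' k' where T': "T = (a', c', h', k')" by (cases T)
    have "(a', c', h', k') \<in> S'" using T z unfolding S'_def T' by auto
    moreover have "snd z \<in> {c'<..<c' + k'}" using T(3) unfolding T' rect_def by auto
    ultimately have "snd z \<in> (\<Union>(a', c', h', k')\<in>S'. {c'<..<c' + k'})" by force
    then show "z \<in> {a<..<a + h} \<times> G" using z unfolding G_def rect_def by (cases z) auto
  qed
  have "ennreal h * ennreal k = emeasure lborel (rect (a, c, h, k))"
    using R by (simp add: emeasure_rect ennreal_mult)
  also have "\<dots> \<le> 2 * emeasure lborel ({a<..<a + h} \<times> G)"
  proof -
    have "{a<..<a + h} \<times> G \<in> sets lborel" by (simp add: borel_Times)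
    then show ?thesis
      by (intro order_trans[OF half[OF False]] mult_left_mono emeasure_mono[OF sub]) auto
  qed
  also have "\<dots> = ennreal h * (2 * emeasure lborel G)"
    using R by (simp add: emeasure_lborel_Times mult_ac)
  finally have "ennreal k \<le> 2 * emeasure lborel G"
    using R by (subst (asm) ennreal_mult_le_mult_iff) auto
  moreover have "{a<..<a + h} \<times> G \<subseteq> (\<Union>T\<in>S. widened T)"
  proof
    fix z assume z: "z \<in> {a<..<a + h} \<times> G"
    then obtain T where T: "T \<in> S'" "case T of (a', c', h', k') \<Rightarrow> snd z \<in> {c'<..<c' + k'}"
      unfolding G_def by (cases z) force
    obtain a' c' h' k' where T': "T = (a', c', h', k')" by (cases T)
    have "z \<in> widened T" using T z unfolding T' S'_def rect_def widened_def by (cases z) auto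
    then show "z \<in> (\<Union>T\<in>S. widened T)" using T(1) unfolding S'_def by blast
  qed
  moreover have "G \<subseteq> {c<..<c + k}" unfolding G_def by blast
  ultimately show ?thesis using that[of G] \<open>G \<in> sets borel\<close> by blast
qed

text \<open>Places the base of a square of side k inside the base of R and around x. For k < h the
  admissible left ends fill an open interval; for k = h the only choice is \<open>a\<close>, which
  is rational.\<close>

lemma exists_rational_subinterval:
  fixes a h k x :: real
  assumes "a \<in> \<rat>" "0 < k" "k \<le> h" "a < x" "x < a + h"
  obtains a' where "a' \<in> \<rat>" "a \<le> a'" "a' + k \<le> a + h" "a' < x" "x < a' + k"
proof (cases "k = h")
  case True
  then show ?thesis using that[of a] assms by auto
next
  case False
  then have "max a (x - k) < min x (a + h - k)" using assms by auto
  then obtain r where "r \<in> \<rat>" "max a (x - k) < r" "r < min x (a + h - k)"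
    using Rats_dense_in_real by blast
  then show ?thesis using that[of r] by auto
qed

text \<open>Through each point of R goes a square with the full height of R and its base inside that
  of R, which exists since k \<le> h. It contains (its base) \<times> G, at least half of its area,
  and this part lies in \<Omega>.\<close>

lemma wide_rectangle_subset_squares:
  assumes R: "a \<in> \<rat>" "c \<in> \<rat>" "k \<in> \<rat>" "0 < k" "k \<le> h"
    and [measurable]: "G \<in> sets borel" "\<Omega> \<in> sets borel"
    and G: "G \<subseteq> {c<..<c + k}" "ennreal k \<le> 2 * emeasure lborel G" "{a<..<a + h} \<times> G \<subseteq> \<Omega>"
  shows "rect (a, c, h, k) \<subseteq> \<Union>{Q\<in>axis_squares. emeasure lborel Q \<le> 2 * emeasure lborel (Q \<inter> \<Omega>)}"
proof
  fix z assume z: "z \<in> rect (a, c, h, k)"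
  then have "a < fst z" "fst z < a + h" unfolding rect_def by auto
  then obtain a' where a': "a' \<in> \<rat>" "a \<le> a'" "a' + k \<le> a + h" "a' < fst z" "fst z < a' + k"
    using exists_rational_subinterval[of a k h "fst z"] R by blast
  let ?Q = "rect (a', c, k, k)"
  have "?Q \<in> axis_squares" unfolding axis_squares_def using R a' by (intro imageI) auto
  moreover have "z \<in> ?Q" using z a' unfolding rect_def by (cases z) auto
  moreover have "emeasure lborel ?Q \<le> 2 * emeasure lborel (?Q \<inter> \<Omega>)"
  proof -
    have "emeasure lborel ?Q = ennreal k * ennreal k" using R by (simp add: emeasure_rect ennreal_mult)
    also have "\<dots> \<le> ennreal k * (2 * emeasure lborel G)" by (intro mult_left_mono G) auto
    also have "\<dots> = 2 * emeasure lborel ({a'<..<a' + k} \<times> G)"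
      using R by (simp add: emeasure_lborel_Times mult_ac)
    also have "\<dots> \<le> 2 * emeasure lborel (?Q \<inter> \<Omega>)"
    proof (intro mult_left_mono emeasure_mono)
      have "{a'<..<a' + k} \<times> G \<subseteq> {a<..<a + h} \<times> G" using a' by auto
      moreover have "{a'<..<a' + k} \<times> G \<subseteq> ?Q" using G(1) unfolding rect_def by auto
      ultimately show "{a'<..<a' + k} \<times> G \<subseteq> ?Q \<inter> \<Omega>" using G(3) by blast
    qed auto
    finally show ?thesis .
  qed
  ultimately show "z \<in> \<Union>{Q\<in>axis_squares. emeasure lborel Q \<le> 2 * emeasure lborel (Q \<inter> \<Omega>)}" by blast
qed

text \<open>On a selected T the weight enters through a single number \<gamma>, and t^q \<gamma>
  \<le> G^q holds on all of T. Integrating over the disjoint sets \<open>E T\<close> leaves an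
  unweighted norm of \<open>G\<close>. The constant is 108 = 18 * 3 * 2: the square covering, the
  tripled width, and |T| \<le> 2|E T|.\<close>

lemma wide_weak_type_finite:
  assumes t: "0 < t" and q: "0 < q" and F: "finite F" "F \<subseteq> wide_rectangles"
    "\<And>R. R \<in> F \<Longrightarrow> ennreal t < avg R f"
    and [measurable]: "w \<in> borel_measurable borel" "u \<in> borel_measurable borel"
      "f \<in> borel_measurable borel" "G \<in> borel_measurable borel"
    and u: "\<And>Q x. Q \<in> axis_squares \<Longrightarrow> x \<in> Q \<Longrightarrow> avg Q w \<le> u x"
    and W: "\<And>R x. R \<in> rectangles \<Longrightarrow> x \<in> R \<Longrightarrow> avg R u \<le> W x"
    and G: "\<And>R x. R \<in> rectangles \<Longrightarrow> x \<in> R \<Longrightarrow> avg R (\<lambda>x. ennreal_powr (W x) (1 / q) * f x) \<le> G x"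
  shows "emeasure (density lborel w) (\<Union>F) \<le> ennreal (t powr - q) * (108 * (\<integral>\<^sup>+x. ennreal_powr (G x) q \<partial>lborel))"
proof -
  let ?I = "{(a, c, h, k). a \<in> \<rat> \<and> c \<in> \<rat> \<and> h \<in> \<rat> \<and> k \<in> \<rat> \<and> 0 < k \<and> k \<le> h} :: (real \<times> real \<times> real \<times> real) set"
  obtain F' where F': "F' \<subseteq> ?I" "finite F'" "F = rect ` F'"
    using finite_subset_image[OF F(1) F(2)[unfolded wide_rectangles_def]] by auto
  obtain S E where S: "S \<subseteq> F'" "disjoint_family_on E S"
    and E: "\<And>T. T \<in> S \<Longrightarrow> E T \<subseteq> rect T \<and> E T \<in> sets lborel \<and> emeasure lborel (rect T) \<le> 2 * emeasure lborel (E T)"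
    and half: "\<And>R. R \<in> F' \<Longrightarrow> R \<notin> S \<Longrightarrow> emeasure lborel (rect R) \<le>
      2 * emeasure lborel (rect R \<inter> (\<Union>T\<in>{T\<in>S. (case R of (a, c, h, k) \<Rightarrow> h) \<le> (case T of (a, c, h, k) \<Rightarrow> h)}. rect T))"
    by (rule half_covered_selection[OF F'(2), of rect lborel "\<lambda>(a, c, h, k). h"]) (simp, blast)
  have "finite S" using S(1) F'(2) finite_subset by blast
  define \<Omega> where "\<Omega> = (\<Union>T\<in>S. widened T)"
  have wm [measurable]: "widened T \<in> sets borel" for T unfolding widened_def by (auto split: prod.split)
  have [measurable]: "\<Omega> \<in> sets borel" unfolding \<Omega>_def using \<open>finite S\<close> by (intro sets.finite_UN) auto
  let ?Qs = "{Q\<in>axis_squares. emeasure lborel Q \<le> 2 * emeasure lborel (Q \<inter> \<Omega>)}"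
  have "rect R \<subseteq> \<Union>?Qs" if "R \<in> F'" for R
  proof -
    obtain a c h k where R: "R = (a, c, h, k)" by (cases R)
    have rat: "a \<in> \<rat>" "c \<in> \<rat>" "h \<in> \<rat>" "k \<in> \<rat>" "0 < k" "k \<le> h" using F'(1) that unfolding R by auto
    have half': "(a, c, h, k) \<notin> S \<Longrightarrow> emeasure lborel (rect (a, c, h, k)) \<le> 2 * emeasure lborel
        (rect (a, c, h, k) \<inter> (\<Union>T\<in>{T\<in>S. h \<le> (case T of (a, c, h, k) \<Rightarrow> h)}. rect T))"
      using half[OF that] unfolding R by simp
    have "0 < h" using rat by simp
    obtain H where "H \<in> sets borel" "H \<subseteq> {c<..<c + k}" "ennreal k \<le> 2 * emeasure lborel H"
      "{a<..<a + h} \<times> H \<subseteq> \<Omega>"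
      unfolding \<Omega>_def
      by (rule wide_rectangle_half_fibre[OF \<open>finite S\<close> \<open>0 < h\<close> \<open>0 < k\<close> half'])
    then show ?thesis unfolding R using rat by (intro wide_rectangle_subset_squares[of a c k h H]) auto
  qed
  then have "\<Union>F \<subseteq> \<Union>?Qs" using F'(3) by blast
  then have "emeasure (density lborel w) (\<Union>F) \<le> emeasure (density lborel w) (\<Union>?Qs)"
  proof (rule emeasure_mono)
    have "countable ?Qs"
      using axis_squares_subset by (intro countable_subset[OF _ countable_rectangles]) auto
    then show "\<Union>?Qs \<in> sets (density lborel w)"
      using axis_squares_subset rectangles_sets by (intro sets.countable_Union) auto
  qed
  also have "\<dots> \<le> 18 * (\<integral>\<^sup>+x\<in>\<Omega>. u x \<partial>lborel)"
    using u by (intro emeasure_density_square_cover) auto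
  also have "(\<integral>\<^sup>+x\<in>\<Omega>. u x \<partial>lborel) \<le> ennreal (t powr - q) * (6 * (\<integral>\<^sup>+x. ennreal_powr (G x) q \<partial>lborel))"
  proof -
    have "(\<integral>\<^sup>+x\<in>\<Omega>. u x \<partial>lborel) = emeasure (density lborel u) (\<Union>T\<in>S. widened T)"
      by (simp add: emeasure_density \<Omega>_def[symmetric])
    also have "\<dots> \<le> (\<Sum>T\<in>S. emeasure (density lborel u) (widened T))"
      using \<open>finite S\<close> by (intro emeasure_subadditive_finite) auto
    also have "\<dots> \<le> (\<Sum>T\<in>S. ennreal (t powr - q) * (6 * (\<integral>\<^sup>+x\<in>E T. ennreal_powr (G x) q \<partial>lborel)))"
    proof (rule sum_mono)
      fix T assume T: "T \<in> S"
      obtain a c h k where T': "T = (a, c, h, k)" by (cases T)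
      have rat: "a \<in> \<rat>" "c \<in> \<rat>" "h \<in> \<rat>" "k \<in> \<rat>" "0 < k" "0 < h"
        using F'(1) S(1) T unfolding T' by force+
      have wT: "widened T \<in> rectangles"
        unfolding T' widened_def using rat by (auto intro!: rect_in_rectangles)
      have rT: "rect T \<in> rectangles" unfolding T' using rat by (intro rect_in_rectangles)
      have sub: "rect T \<subseteq> widened T" unfolding T' by (rule rect_subset_widened)
      have vol: "emeasure lborel (widened T) = 3 * emeasure lborel (rect T)"
        unfolding T' widened_def using rat by (simp add: emeasure_rect ennreal_mult mult.assoc)
      have [measurable]: "E T \<in> sets borel" using E[OF T] by simp
      \<comment> \<open>Since T lies in \<open>widened T\<close>, \<gamma> is at most W at every
        point of T, so \<gamma>^(1/q) can be replaced by W^(1/q) inside the average over T.\<close>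
      define \<gamma> where "\<gamma> = avg (widened T) u"
      have ptw: "ennreal (t powr q) * \<gamma> \<le> ennreal_powr (G x) q" if "x \<in> rect T" for x
      proof -
        have "ennreal (t powr q) * \<gamma> = ennreal_powr (ennreal t * ennreal_powr \<gamma> (1 / q)) q"
          using t q by (simp add: ennreal_powr_mult ennreal_powr_powr ennreal_powr_ennreal)
        also have "\<dots> \<le> ennreal_powr (G x) q"
        proof (rule ennreal_powr_mono[OF q])
          have "ennreal t * ennreal_powr \<gamma> (1 / q) \<le> avg (rect T) f * ennreal_powr \<gamma> (1 / q)"
            using F(3)[of "rect T"] F'(3) S(1) T by (intro mult_right_mono) auto
          also have "\<dots> = avg (rect T) (\<lambda>x. ennreal_powr \<gamma> (1 / q) * f x)"
            by (subst avg_cmult) (auto simp: mult.commute)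
          also have "\<dots> \<le> avg (rect T) (\<lambda>x. ennreal_powr (W x) (1 / q) * f x)"
            using W[OF wT] sub q unfolding \<gamma>_def
            by (intro avg_mono mult_right_mono ennreal_powr_mono) auto
          also have "\<dots> \<le> G x" by (rule G[OF rT that])
          finally show "ennreal t * ennreal_powr \<gamma> (1 / q) \<le> G x" .
        qed
        finally show ?thesis .
      qed
      have "emeasure (density lborel u) (widened T) = \<gamma> * emeasure lborel (widened T)"
        unfolding \<gamma>_def using rectangles_emeasure[OF wT]
        by (subst avg_mult_emeasure) (auto simp: emeasure_density)
      also have "\<dots> \<le> \<gamma> * (3 * (2 * emeasure lborel (E T)))"
        unfolding vol using E[OF T] by (intro mult_left_mono) auto
      also have "\<dots> = ennreal (t powr - q) * (6 * ((ennreal (t powr q) * \<gamma>) * emeasure lborel (E T)))"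
      proof -
        \<comment> \<open>This factor 1 is inserted to form the product t^q \<gamma> bounded in
          \<open>ptw\<close>.\<close>
        have "ennreal (t powr - q) * ennreal (t powr q) = 1"
          using t by (simp add: ennreal_mult[symmetric] flip: powr_add)
        then have "\<gamma> * (3 * (2 * emeasure lborel (E T))) =
            (ennreal (t powr - q) * ennreal (t powr q)) * (\<gamma> * (6 * emeasure lborel (E T)))"
          by (simp add: mult.assoc[symmetric] mult.commute[of \<gamma>])
        then show ?thesis by (simp only: mult_ac)
      qed
      also have "(ennreal (t powr q) * \<gamma>) * emeasure lborel (E T) = (\<integral>\<^sup>+x\<in>E T. ennreal (t powr q) * \<gamma> \<partial>lborel)"
        by (subst nn_integral_cmult_indicator) auto
      also have "\<dots> \<le> (\<integral>\<^sup>+x\<in>E T. ennreal_powr (G x) q \<partial>lborel)"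
        using ptw E[OF T] by (intro nn_integral_mono) (auto simp: indicator_def)
      finally show "emeasure (density lborel u) (widened T) \<le>
          ennreal (t powr - q) * (6 * (\<integral>\<^sup>+x\<in>E T. ennreal_powr (G x) q \<partial>lborel))"
        by (simp add: mult_left_mono)
    qed
    also have "\<dots> = ennreal (t powr - q) * (6 * (\<Sum>T\<in>S. \<integral>\<^sup>+x\<in>E T. ennreal_powr (G x) q \<partial>lborel))"
      by (simp add: sum_distrib_left)
    also have "(\<Sum>T\<in>S. \<integral>\<^sup>+x\<in>E T. ennreal_powr (G x) q \<partial>lborel) \<le> (\<integral>\<^sup>+x\<in>UNIV. ennreal_powr (G x) q \<partial>lborel)"
      using \<open>finite S\<close> S(2) E by (intro sum_set_nn_integral_disjoint_le) auto
    finally show ?thesis by (simp add: mult_left_mono)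
  qed
  also have "18 * (ennreal (t powr - q) * (6 * (\<integral>\<^sup>+x. ennreal_powr (G x) q \<partial>lborel))) =
      ennreal (t powr - q) * (108 * (\<integral>\<^sup>+x. ennreal_powr (G x) q \<partial>lborel))"
    by (subst mult.left_commute) (simp flip: mult.assoc)
  finally show ?thesis by (simp add: mult_left_mono)
qed

section \<open>Strong type bound for all rectangles\<close>

lemma ennreal_powr_of_bool: "ennreal_powr (x * of_bool P) q = ennreal_powr x q * of_bool P"
  by (cases P) auto

lemma wide_strong_type:
  assumes "1 < p"
  obtains C :: real where "0 < C"
    "\<And>w u W f. w \<in> borel_measurable borel \<Longrightarrow> u \<in> borel_measurable borel \<Longrightarrow>
      W \<in> borel_measurable borel \<Longrightarrow> f \<in> borel_measurable borel \<Longrightarrow>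
      (\<And>Q x. Q \<in> axis_squares \<Longrightarrow> x \<in> Q \<Longrightarrow> avg Q w \<le> u x) \<Longrightarrow>
      (\<And>R x. R \<in> rectangles \<Longrightarrow> x \<in> R \<Longrightarrow> avg R u \<le> W x) \<Longrightarrow>
      (\<integral>\<^sup>+x. ennreal_powr (maxop wide_rectangles f x) p * w x \<partial>lborel) \<le>
        ennreal C * (\<integral>\<^sup>+x. ennreal_powr (f x) p * W x \<partial>lborel)"
proof -
  \<comment> \<open>Any exponent strictly between 1 and p would do: q > 1 for the unweighted bound,
    q < p for interpolation.\<close>
  define q where "q = (1 + p) / 2"
  have q: "1 < q" "q < p" using assms by (auto simp: q_def)
  obtain C where C: "0 < C" "\<And>g. g \<in> borel_measurable borel \<Longrightarrow>
    \<exists>G. G \<in> borel_measurable borel \<and> (\<forall>R\<in>rectangles. \<forall>z\<in>R. avg R g \<le> G z) \<and>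
      (\<integral>\<^sup>+z. ennreal_powr (G z) q \<partial>lborel) \<le> ennreal C * (\<integral>\<^sup>+z. ennreal_powr (g z) q \<partial>lborel)"
    using rectangles_majorant[OF q(1)] by blast
  define D where "D = 2 powr (2 * p - q) / (1 - 2 powr (q - p))"
  \<comment> \<open>The factor 2^q arises because the finite weak type bound is applied at level t/2
    after the cutoff.\<close>
  define K where "K = 2 powr q * (108 * C)"
  have "2 powr (q - p) < (1::real)" using q by (simp add: powr_less_one)
  then have pos: "0 < D" "0 < K" using C(1) by (auto simp: D_def K_def)
  have "(\<integral>\<^sup>+x. ennreal_powr (maxop wide_rectangles f x) p * w x \<partial>lborel) \<le>
        ennreal (D * K) * (\<integral>\<^sup>+x. ennreal_powr (f x) p * W x \<partial>lborel)"
    if meas [measurable]: "w \<in> borel_measurable borel" "u \<in> borel_measurable borel"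
      "W \<in> borel_measurable borel" "f \<in> borel_measurable borel"
      and u: "\<And>Q x. Q \<in> axis_squares \<Longrightarrow> x \<in> Q \<Longrightarrow> avg Q w \<le> u x"
      and W: "\<And>R x. R \<in> rectangles \<Longrightarrow> x \<in> R \<Longrightarrow> avg R u \<le> W x"
    for w u W f :: "real \<times> real \<Rightarrow> ennreal"
  proof -
    have wide: "countable {R\<in>wide_rectangles. P R}" "{R\<in>wide_rectangles. P R} \<subseteq> sets borel" for P
      using wide_rectangles_subset rectangles_sets
      by (auto intro!: countable_subset[OF _ countable_rectangles])
    have [measurable]: "maxop wide_rectangles f \<in> borel_measurable borel"
      using wide[of "\<lambda>_. True"] by (intro measurable_maxop) auto
    have "(\<integral>\<^sup>+x. ennreal_powr (maxop wide_rectangles f x) p \<partial>density lborel w) \<le>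
        ennreal D * (ennreal K * (\<integral>\<^sup>+x. ennreal_powr (f x) p \<partial>density lborel W))"
      unfolding D_def
    proof (rule marcinkiewicz_dyadic)
      fix t :: real assume t: "0 < t"
      let ?h = "\<lambda>x. f x * of_bool (ennreal (t / 2) < f x)"
      have "{x \<in> space (density lborel w). ennreal t < maxop wide_rectangles f x} \<subseteq>
          \<Union>{R \<in> wide_rectangles. ennreal (t / 2) < avg R ?h}"
      proof
        fix x assume "x \<in> {x \<in> space (density lborel w). ennreal t < maxop wide_rectangles f x}"
        then obtain R where R: "x \<in> R" "R \<in> wide_rectangles" "ennreal t < avg R f"
          by (auto simp: less_maxop_iff)
        then have "ennreal (t / 2) < avg R ?h"
          using t wide(2)[of "\<lambda>_. True"] by (intro avg_cutoff) auto
        then show "x \<in> \<Union>{R \<in> wide_rectangles. ennreal (t / 2) < avg R ?h}" using R by blast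
      qed
      then have "emeasure (density lborel w) {x \<in> space (density lborel w). ennreal t < maxop wide_rectangles f x} \<le>
          emeasure (density lborel w) (\<Union>{R \<in> wide_rectangles. ennreal (t / 2) < avg R ?h})"
        using wide by (intro emeasure_mono) (auto intro!: sets.countable_Union)
      also have "\<dots> \<le> ennreal ((t / 2) powr - q) * (108 * (ennreal C * (\<integral>\<^sup>+x. W x * (ennreal_powr (f x) q * of_bool (ennreal (t / 2) < f x)) \<partial>lborel)))"
      proof (rule emeasure_UN_le_if_finite)
        fix F assume F: "finite F" "F \<subseteq> {R \<in> wide_rectangles. ennreal (t / 2) < avg R ?h}"
        \<comment> \<open>Chosen so that g^q = W h^q: the unweighted q-norm of g is the W-weighted
          q-norm of the truncated f.\<close>
        let ?g = "\<lambda>x. ennreal_powr (W x) (1 / q) * ?h x"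
        have "?g \<in> borel_measurable borel" by measurable
        from C(2)[OF this] obtain G where G: "G \<in> borel_measurable borel"
          "\<forall>R\<in>rectangles. \<forall>z\<in>R. avg R ?g \<le> G z"
          "(\<integral>\<^sup>+z. ennreal_powr (G z) q \<partial>lborel) \<le> ennreal C * (\<integral>\<^sup>+z. ennreal_powr (?g z) q \<partial>lborel)"
          by blast
        have "emeasure (density lborel w) (\<Union>F) \<le> ennreal ((t / 2) powr - q) * (108 * (\<integral>\<^sup>+x. ennreal_powr (G x) q \<partial>lborel))"
          using t q F G(1,2) u W
          by (intro wide_weak_type_finite[where f = ?h and u = u and W = W]) auto
        also have "\<dots> \<le> ennreal ((t / 2) powr - q) * (108 * (ennreal C * (\<integral>\<^sup>+z. ennreal_powr (?g z) q \<partial>lborel)))"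
          by (intro mult_left_mono G(3)) auto
        also have "(\<lambda>z. ennreal_powr (?g z) q) = (\<lambda>z. W z * (ennreal_powr (f z) q * of_bool (ennreal (t / 2) < f z)))"
          using q by (auto simp: ennreal_powr_mult ennreal_powr_powr ennreal_powr_of_bool)
        finally show "emeasure (density lborel w) (\<Union>F) \<le> ennreal ((t / 2) powr - q) * (108 * (ennreal C * (\<integral>\<^sup>+x. W x * (ennreal_powr (f x) q * of_bool (ennreal (t / 2) < f x)) \<partial>lborel)))" .
      qed (use wide in auto)
      also have "\<dots> = ennreal (t powr - q) * (ennreal K * (\<integral>\<^sup>+x. ennreal_powr (f x) q * of_bool (ennreal (t / 2) < f x) \<partial>density lborel W))"
      proof -
        have "(t / 2) powr - q * (108 * C) = t powr - q * K"
          using t by (simp add: K_def powr_divide powr_minus divide_simps)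
        then have "ennreal ((t / 2) powr - q) * (108 * ennreal C) = ennreal (t powr - q) * ennreal K"
          using C(1) pos by (simp add: ennreal_mult[symmetric] flip: ennreal_numeral)
        then show ?thesis by (subst nn_integral_density) (auto simp flip: mult.assoc)
      qed
      finally show "emeasure (density lborel w) {x \<in> space (density lborel w). ennreal t < maxop wide_rectangles f x} \<le>
        ennreal (t powr - q) * (ennreal K * (\<integral>\<^sup>+x. ennreal_powr (f x) q * of_bool (ennreal (t / 2) < f x) \<partial>density lborel W))" .
    qed (use q in auto)
    then show ?thesis
      using pos by (simp add: nn_integral_density ennreal_mult mult_ac)
  qed
  then show ?thesis using that[of "D * K"] pos by simp
qed

section \<open>Reflection in the diagonal\<close>

lemma nn_integral_lborel_swap:
  fixes h :: "real \<times> real \<Rightarrow> ennreal"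
  assumes "h \<in> borel_measurable borel"
  shows "(\<integral>\<^sup>+z. h (prod.swap z) \<partial>lborel) = (\<integral>\<^sup>+z. h z \<partial>lborel)"
proof -
  have [measurable]: "h \<in> borel_measurable (borel \<Otimes>\<^sub>M borel)" using assms by (simp add: borel_prod)
  have "(\<integral>\<^sup>+z. h z \<partial>(lborel \<Otimes>\<^sub>M lborel)) =
      (\<integral>\<^sup>+z. h z \<partial>distr (lborel \<Otimes>\<^sub>M lborel) (lborel \<Otimes>\<^sub>M lborel) (\<lambda>(x, y). (y, x)))"
    by (subst lborel_pair.distr_pair_swap) simp
  also have "\<dots> = (\<integral>\<^sup>+z. h (case z of (x, y) \<Rightarrow> (y, x)) \<partial>(lborel \<Otimes>\<^sub>M lborel))"
    by (rule nn_integral_distr) measurable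
  finally show ?thesis by (simp add: lborel_prod prod.swap_def case_prod_unfold)
qed

lemma measurable_swap_comp:
  fixes h :: "real \<times> real \<Rightarrow> ennreal"
  shows "h \<in> borel_measurable borel \<Longrightarrow> (\<lambda>z. h (prod.swap z)) \<in> borel_measurable borel"
  by (rule measurable_compose[of prod.swap]) (auto intro: borel_measurable_continuous_onI continuous_on_swap)

lemma avg_swap:
  fixes g :: "real \<times> real \<Rightarrow> ennreal"
  assumes [measurable]: "g \<in> borel_measurable borel" "B \<in> sets borel" "prod.swap ` B \<in> sets borel"
  shows "avg (prod.swap ` B) g = avg B (\<lambda>z. g (prod.swap z))"
proof -
  have ind: "indicator (prod.swap ` B) (prod.swap z) = (indicator B z :: ennreal)" for z :: "real \<times> real"
    by (auto simp: indicator_def inj_image_mem_iff)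
  have "(\<integral>\<^sup>+z\<in>prod.swap ` B. g z \<partial>lborel) = (\<integral>\<^sup>+z\<in>B. g (prod.swap z) \<partial>lborel)"
    by (subst nn_integral_lborel_swap[symmetric]) (auto simp: ind)
  moreover have "emeasure lborel (prod.swap ` B) = emeasure lborel B"
    using nn_integral_lborel_swap[of "indicator (prod.swap ` B)"] by (simp add: ind)
  ultimately show ?thesis by (simp add: avg_def)
qed

lemma swap_rect: "prod.swap ` rect (a, c, h, k) = rect (c, a, k, h)"
  by (auto simp: rect_def product_swap)

lemma swap_rectangles: "R \<in> rectangles \<Longrightarrow> prod.swap ` R \<in> rectangles"
  unfolding rectangles_def mem_Collect_eq by (metis product_swap)

lemma swap_axis_squares: "Q \<in> axis_squares \<Longrightarrow> prod.swap ` Q \<in> axis_squares"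
  unfolding axis_squares_def by (auto simp: swap_rect intro!: imageI)

lemma rectangles_wide_or_tall:
  assumes "R \<in> rectangles"
  shows "R \<in> wide_rectangles \<or> prod.swap ` R \<in> wide_rectangles"
proof -
  obtain a b c d where R: "R = {a<..<b} \<times> {c<..<d}" "a \<in> \<rat>" "b \<in> \<rat>" "c \<in> \<rat>" "d \<in> \<rat>" "a < b" "c < d"
    using assms unfolding rectangles_def intervals_def by auto
  have "R = rect (a, c, b - a, d - c)" by (simp add: R(1) rect_def)
  moreover have "rect (a, c, b - a, d - c) \<in> wide_rectangles" if "d - c \<le> b - a"
    unfolding wide_rectangles_def using R that by (intro imageI) auto
  moreover have "rect (c, a, d - c, b - a) \<in> wide_rectangles" if "\<not> d - c \<le> b - a"
    unfolding wide_rectangles_def using R that by (intro imageI) auto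
  ultimately show ?thesis by (metis swap_rect)
qed

lemma maxop_rectangles_le:
  assumes "f \<in> borel_measurable borel"
  shows "maxop rectangles f z \<le>
    max (maxop wide_rectangles f z) (maxop wide_rectangles (\<lambda>z. f (prod.swap z)) (prod.swap z))"
  unfolding maxop_def[of rectangles]
proof (rule SUP_least)
  fix R assume R: "R \<in> {B \<in> rectangles. z \<in> B}"
  consider "R \<in> wide_rectangles" | "prod.swap ` R \<in> wide_rectangles"
    using rectangles_wide_or_tall R by blast
  then show "avg R f \<le> max (maxop wide_rectangles f z) (maxop wide_rectangles (\<lambda>z. f (prod.swap z)) (prod.swap z))"
  proof cases
    case 1
    then show ?thesis using R by (auto intro: avg_le_maxop max.coboundedI1)
  next
    case 2
    have "prod.swap ` prod.swap ` R = R" by (simp add: image_comp)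
    then have "avg R f = avg (prod.swap ` R) (\<lambda>z. f (prod.swap z))"
      using R assms swap_rectangles rectangles_sets avg_swap[of f "prod.swap ` R"] by auto
    also have "\<dots> \<le> maxop wide_rectangles (\<lambda>z. f (prod.swap z)) (prod.swap z)"
      using 2 R by (intro avg_le_maxop) auto
    finally show ?thesis by (rule max.coboundedI2)
  qed
qed

text \<open>Swapping coordinates makes tall rectangles wide and preserves
  \<open>axis_squares\<close> and \<open>rectangles\<close>, so the reflected \<open>w\<close>,
  \<open>u\<close>, \<open>W\<close> satisfy the same hypotheses. This is why \<open>u\<close> and
  \<open>W\<close> are arbitrary majorants of averages. The 2 comes from bounding a maximum by a
  sum.\<close>

lemma rectangles_strong_type:
  assumes p: "1 < p"
  obtains C :: real where "0 < C"
    "\<And>w u W f. w \<in> borel_measurable borel \<Longrightarrow> u \<in> borel_measurable borel \<Longrightarrow>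
      W \<in> borel_measurable borel \<Longrightarrow> f \<in> borel_measurable borel \<Longrightarrow>
      (\<And>Q x. Q \<in> axis_squares \<Longrightarrow> x \<in> Q \<Longrightarrow> avg Q w \<le> u x) \<Longrightarrow>
      (\<And>R x. R \<in> rectangles \<Longrightarrow> x \<in> R \<Longrightarrow> avg R u \<le> W x) \<Longrightarrow>
      (\<integral>\<^sup>+x. ennreal_powr (maxop rectangles f x) p * w x \<partial>lborel) \<le>
        ennreal C * (\<integral>\<^sup>+x. ennreal_powr (f x) p * W x \<partial>lborel)"
proof -
  obtain C where C: "0 < C"
    "\<And>w u W f. w \<in> borel_measurable borel \<Longrightarrow> u \<in> borel_measurable borel \<Longrightarrow>
      W \<in> borel_measurable borel \<Longrightarrow> f \<in> borel_measurable borel \<Longrightarrow>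
      (\<And>Q x. Q \<in> axis_squares \<Longrightarrow> x \<in> Q \<Longrightarrow> avg Q w \<le> u x) \<Longrightarrow>
      (\<And>R x. R \<in> rectangles \<Longrightarrow> x \<in> R \<Longrightarrow> avg R u \<le> W x) \<Longrightarrow>
      (\<integral>\<^sup>+x. ennreal_powr (maxop wide_rectangles f x) p * w x \<partial>lborel) \<le>
        ennreal C * (\<integral>\<^sup>+x. ennreal_powr (f x) p * W x \<partial>lborel)"
    using wide_strong_type[OF p] by blast
  have "(\<integral>\<^sup>+x. ennreal_powr (maxop rectangles f x) p * w x \<partial>lborel) \<le>
        ennreal (2 * C) * (\<integral>\<^sup>+x. ennreal_powr (f x) p * W x \<partial>lborel)"
    if meas [measurable]: "w \<in> borel_measurable borel" "u \<in> borel_measurable borel"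
      "W \<in> borel_measurable borel" "f \<in> borel_measurable borel"
      and u: "\<And>Q x. Q \<in> axis_squares \<Longrightarrow> x \<in> Q \<Longrightarrow> avg Q w \<le> u x"
      and W: "\<And>R x. R \<in> rectangles \<Longrightarrow> x \<in> R \<Longrightarrow> avg R u \<le> W x"
    for w u W f :: "real \<times> real \<Rightarrow> ennreal"
  proof -
    let ?m = "maxop wide_rectangles f" and ?m' = "maxop wide_rectangles (\<lambda>z. f (prod.swap z))"
    note sw = meas[THEN measurable_swap_comp]
    have wide: "countable wide_rectangles" "wide_rectangles \<subseteq> sets borel"
      using wide_rectangles_subset rectangles_sets
      by (auto intro: countable_subset[OF _ countable_rectangles])
    have [measurable]: "?m \<in> borel_measurable borel" and m': "?m' \<in> borel_measurable borel"
      using wide by (auto intro: measurable_maxop)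
    note [measurable] = measurable_swap_comp[OF m']
    have "(\<integral>\<^sup>+z. ennreal_powr (maxop rectangles f z) p * w z \<partial>lborel) \<le>
        (\<integral>\<^sup>+z. ennreal_powr (?m z) p * w z + ennreal_powr (?m' (prod.swap z)) p * w z \<partial>lborel)"
    proof (intro nn_integral_mono)
      fix z
      have "ennreal_powr (maxop rectangles f z) p \<le> ennreal_powr (max (?m z) (?m' (prod.swap z))) p"
        using p by (intro ennreal_powr_mono maxop_rectangles_le meas) auto
      also have "\<dots> \<le> ennreal_powr (?m z) p + ennreal_powr (?m' (prod.swap z)) p"
        using p by (intro ennreal_powr_max) auto
      finally show "ennreal_powr (maxop rectangles f z) p * w z \<le>
          ennreal_powr (?m z) p * w z + ennreal_powr (?m' (prod.swap z)) p * w z"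
        by (metis distrib_right mult_right_mono zero_le)
    qed
    also have "\<dots> = (\<integral>\<^sup>+z. ennreal_powr (?m z) p * w z \<partial>lborel) +
        (\<integral>\<^sup>+z. ennreal_powr (?m' (prod.swap z)) p * w z \<partial>lborel)"
      by (rule nn_integral_add) measurable
    also have "\<dots> \<le> ennreal C * (\<integral>\<^sup>+x. ennreal_powr (f x) p * W x \<partial>lborel) +
        ennreal C * (\<integral>\<^sup>+x. ennreal_powr (f x) p * W x \<partial>lborel)"
    proof (rule add_mono)
      show "(\<integral>\<^sup>+z. ennreal_powr (?m z) p * w z \<partial>lborel) \<le> ennreal C * (\<integral>\<^sup>+x. ennreal_powr (f x) p * W x \<partial>lborel)"
        using u W by (intro C(2)[where u = u]) auto
      have "(\<integral>\<^sup>+z. ennreal_powr (?m' (prod.swap z)) p * w z \<partial>lborel) =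
          (\<integral>\<^sup>+z. ennreal_powr (?m' z) p * w (prod.swap z) \<partial>lborel)"
      proof -
        have "(\<lambda>z. ennreal_powr (?m' z) p * w (prod.swap z)) \<in> borel_measurable borel"
          by (intro borel_measurable_times_ennreal measurable_ennreal_powr m' sw(1))
        from nn_integral_lborel_swap[OF this] show ?thesis by (simp only: swap_swap)
      qed
      also have "\<dots> \<le> ennreal C * (\<integral>\<^sup>+z. ennreal_powr (f (prod.swap z)) p * W (prod.swap z) \<partial>lborel)"
      proof (rule C(2)[OF sw])
        fix Q z assume Q: "Q \<in> axis_squares" "z \<in> Q"
        then have "avg Q (\<lambda>z. w (prod.swap z)) = avg (prod.swap ` Q) w"
          using swap_axis_squares axis_squares_subset rectangles_sets by (intro avg_swap[symmetric] meas) auto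
        then show "avg Q (\<lambda>z. w (prod.swap z)) \<le> u (prod.swap z)"
          using u[of "prod.swap ` Q" "prod.swap z"] Q swap_axis_squares by auto
      next
        fix R z assume R: "R \<in> rectangles" "z \<in> R"
        then have "avg R (\<lambda>z. u (prod.swap z)) = avg (prod.swap ` R) u"
          using swap_rectangles rectangles_sets by (intro avg_swap[symmetric] meas) auto
        then show "avg R (\<lambda>z. u (prod.swap z)) \<le> W (prod.swap z)"
          using W[of "prod.swap ` R" "prod.swap z"] R swap_rectangles by auto
      qed
      also have "(\<integral>\<^sup>+z. ennreal_powr (f (prod.swap z)) p * W (prod.swap z) \<partial>lborel) =
          (\<integral>\<^sup>+z. ennreal_powr (f z) p * W z \<partial>lborel)"
        by (rule nn_integral_lborel_swap) measurable
      finally show "(\<integral>\<^sup>+z. ennreal_powr (?m' (prod.swap z)) p * w z \<partial>lborel) \<le>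
          ennreal C * (\<integral>\<^sup>+x. ennreal_powr (f x) p * W x \<partial>lborel)" .
    qed
    also have "\<dots> = ennreal (2 * C) * (\<integral>\<^sup>+x. ennreal_powr (f x) p * W x \<partial>lborel)"
      using C(1) by (subst ennreal_mult) (auto simp: distrib_right mult_2)
    finally show ?thesis .
  qed
  then show ?thesis using that[of "2 * C"] C(1) by simp
qed

section \<open>Transfer to the plane\<close>

text \<open>\<open>vec2\<close> and \<open>pair2\<close> are mutually inverse and preserve Lebesgue
  measure; Tonelli is applied on the product, the theorem lives on \<open>real^2\<close>.\<close>

definition vec2 :: "real \<times> real \<Rightarrow> real^2" where
  "vec2 z = (\<chi> i. if i = 1 then fst z else snd z)"

definition pair2 :: "real^2 \<Rightarrow> real \<times> real" where
  "pair2 v = (v $ 1, v $ 2)"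

lemma vec2_nth [simp]: "vec2 z $ 1 = fst z" "vec2 z $ 2 = snd z"
  by (simp_all add: vec2_def)

lemma pair2_vec2 [simp]: "pair2 (vec2 z) = z"
  by (simp add: pair2_def)

lemma vec2_pair2 [simp]: "vec2 (pair2 v) = v"
  by (simp add: pair2_def vec_eq_iff forall_2)

lemma measurable_vec2 [measurable]: "vec2 \<in> borel_measurable borel"
proof (rule borel_measurable_continuous_onI)
  have "continuous_on UNIV (\<lambda>z :: real \<times> real. if i = 1 then fst z else snd z)" for i :: 2
    by (cases "i = 1") (auto intro!: continuous_intros)
  then show "continuous_on UNIV vec2"
    unfolding vec2_def by (intro continuous_on_vec_lambda)
qed

lemma measurable_pair2 [measurable]: "pair2 \<in> borel_measurable borel"
  unfolding pair2_def by (intro borel_measurable_continuous_onI continuous_intros)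

lemma Basis_vec2: "(Basis :: (real^2) set) = {axis 1 1, axis 2 1}"
  by (auto simp: Basis_vec_def UNIV_2)

lemma prod_Basis_vec2: "(\<Prod>b\<in>Basis. (v :: real^2) \<bullet> b) = v $ 1 * v $ 2"
  by (simp add: Basis_vec2 axis_eq_axis inner_axis)

lemma distr_lborel_vec2: "distr lborel borel vec2 = (lborel :: (real^2) measure)"
proof (rule lborel_eqI[symmetric])
  fix l u :: "real^2" assume "\<And>b. b \<in> Basis \<Longrightarrow> l \<bullet> b \<le> u \<bullet> b"
  then have le: "l $ 1 \<le> u $ 1" "l $ 2 \<le> u $ 2"
    by (force simp: Basis_vec2 inner_axis)+
  have "vec2 -` box l u = {l $ 1<..<u $ 1} \<times> {l $ 2<..<u $ 2}"
    by (auto simp: mem_box_cart forall_2)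
  then show "emeasure (distr lborel borel vec2) (box l u) = ennreal (\<Prod>b\<in>Basis. (u - l) \<bullet> b)"
    using le by (simp add: emeasure_distr emeasure_lborel_Times prod_Basis_vec2 ennreal_mult)
qed simp

lemma nn_integral_lebesgue_pair2:
  assumes [measurable]: "h \<in> borel_measurable borel"
  shows "(\<integral>\<^sup>+v. h (pair2 v) \<partial>lebesgue) = (\<integral>\<^sup>+z. h z \<partial>lborel)"
proof -
  have "(\<integral>\<^sup>+v. h (pair2 v) \<partial>lebesgue) = (\<integral>\<^sup>+v. h (pair2 v) \<partial>distr lborel borel vec2)"
    by (simp add: nn_integral_completion distr_lborel_vec2)
  also have "\<dots> = (\<integral>\<^sup>+z. h (pair2 (vec2 z)) \<partial>lborel)"
    by (rule nn_integral_distr) measurable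
  finally show ?thesis by simp
qed

lemma emeasure_lebesgue_cbox_vec2:
  fixes a b :: "real^2"
  assumes "a $ 1 < b $ 1" "a $ 2 < b $ 2"
  shows "emeasure lebesgue (cbox a b) = ennreal ((b $ 1 - a $ 1) * (b $ 2 - a $ 2))"
proof -
  have le: "a \<bullet> i \<le> b \<bullet> i" if "i \<in> Basis" for i
    using assms that by (auto simp: Basis_vec2 inner_axis)
  have "emeasure lebesgue (cbox a b) = ennreal (\<Prod>i\<in>Basis. (b - a) \<bullet> i)"
    using emeasure_lborel_cbox[OF le] by simp
  then show ?thesis by (simp add: prod_Basis_vec2)
qed

text \<open>Monotonicity of the integral in one direction, so \<open>K\<close> may be an arbitrary
  function, such as a maximal function over all rotated squares. The open rectangle and its closure
  have equal measure.\<close>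

lemma avg_le_lebesgue_average:
  assumes [measurable]: "k \<in> borel_measurable borel" and le: "AE v in lebesgue. k (pair2 v) \<le> K v"
    and ab: "a < b" "c < d"
  shows "avg ({a<..<b} \<times> {c<..<d}) k \<le>
    (\<integral>\<^sup>+v\<in>cbox (vec2 (a, c)) (vec2 (b, d)). K v \<partial>lebesgue) / emeasure lebesgue (cbox (vec2 (a, c)) (vec2 (b, d)))"
proof -
  let ?R = "{a<..<b} \<times> {c<..<d}" and ?B = "cbox (vec2 (a, c)) (vec2 (b, d))"
  have [measurable]: "?R \<in> sets borel" by (intro borel_Times) auto
  have sub: "v \<in> ?B" if "pair2 v \<in> ?R" for v
    using that by (auto simp: pair2_def mem_box_cart forall_2)
  have "(\<integral>\<^sup>+z\<in>?R. k z \<partial>lborel) = (\<integral>\<^sup>+v. k (pair2 v) * indicator ?R (pair2 v) \<partial>lebesgue)"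
    by (rule nn_integral_lebesgue_pair2[symmetric]) measurable
  also have "\<dots> \<le> (\<integral>\<^sup>+v\<in>?B. K v \<partial>lebesgue)"
    using le sub by (intro nn_integral_mono_AE) (auto simp: indicator_def elim!: eventually_mono)
  finally have "(\<integral>\<^sup>+z\<in>?R. k z \<partial>lborel) \<le> (\<integral>\<^sup>+v\<in>?B. K v \<partial>lebesgue)" .
  moreover have "emeasure lborel ?R = emeasure lebesgue ?B"
    using ab by (subst emeasure_lebesgue_cbox_vec2) (auto simp: emeasure_lborel_Times ennreal_mult)
  ultimately show ?thesis by (simp add: avg_def divide_right_mono_ennreal)
qed

lemma cbox_in_squares:
  assumes "0 < h"
  shows "cbox (vec2 (a, c)) (vec2 (a + h, c + h)) \<in> squares"
proof -
  have "cbox (vec2 (a, c)) (vec2 (a + h, c + h)) =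
      {vec2 (a, c) + s *\<^sub>R axis 1 1 + t *\<^sub>R axis 2 1 | s t. 0 \<le> s \<and> s \<le> h \<and> 0 \<le> t \<and> t \<le> h}"
    (is "_ = ?S")
  proof (intro subset_antisym subsetI)
    fix x assume x: "x \<in> cbox (vec2 (a, c)) (vec2 (a + h, c + h))"
    have "x = vec2 (a, c) + (x $ 1 - a) *\<^sub>R axis 1 1 + (x $ 2 - c) *\<^sub>R axis 2 1"
      by (simp add: vec_eq_iff forall_2 axis_def)
    moreover have "0 \<le> x $ 1 - a" "x $ 1 - a \<le> h" "0 \<le> x $ 2 - c" "x $ 2 - c \<le> h"
      using x by (auto simp: mem_box_cart forall_2)
    ultimately show "x \<in> ?S" by blast
  next
    fix x assume "x \<in> ?S"
    then show "x \<in> cbox (vec2 (a, c)) (vec2 (a + h, c + h))"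
      by (auto simp: mem_box_cart forall_2 axis_def)
  qed
  then show ?thesis
    unfolding squares_def using assms
    by (intro CollectI exI[of _ "vec2 (a, c)"] exI[of _ "axis 1 1"] exI[of _ "axis 2 1"] exI[of _ h])
       (simp add: inner_axis_axis axis_eq_axis)
qed

section \<open>Comparing the maximal operators with their rational versions\<close>

lemma le_maximal_op:
  "B \<in> \<B> \<Longrightarrow> v \<in> B \<Longrightarrow> (\<integral>\<^sup>+y\<in>B. g y \<partial>lebesgue) / emeasure lebesgue B \<le> maximal_op \<B> g v"
  unfolding maximal_op_def by (rule SUP_upper2[of B]) auto

text \<open>\<open>W\<close> stands on the larger side of the theorem, so it may be replaced by
  something smaller: the rational axis-parallel squares are, up to their boundaries, among all
  squares.\<close>

lemma maxop_axis_squares_le_HL: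
  assumes "k \<in> borel_measurable borel" "AE v in lebesgue. k (pair2 v) \<le> K v"
  shows "maxop axis_squares k (pair2 v) \<le> HL_maximal K v"
  unfolding maxop_def
proof (rule SUP_least)
  fix Q assume "Q \<in> {Q \<in> axis_squares. pair2 v \<in> Q}"
  then obtain a c h where Q: "Q = {a<..<a + h} \<times> {c<..<c + h}" "0 < h" "pair2 v \<in> Q"
    unfolding axis_squares_def rect_def by auto
  have "v \<in> cbox (vec2 (a, c)) (vec2 (a + h, c + h))"
    using Q(3) unfolding Q(1) by (auto simp: pair2_def mem_box_cart forall_2)
  then show "avg Q k \<le> HL_maximal K v"
    unfolding Q(1) using Q(2)
    by (intro order_trans[OF avg_le_lebesgue_average[OF assms]] le_maximal_op cbox_in_squares) auto
qed

lemma maxop_rectangles_le_strong: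
  assumes "k \<in> borel_measurable borel" "AE v in lebesgue. k (pair2 v) \<le> K v"
  shows "maxop rectangles k (pair2 v) \<le> strong_maximal K v"
  unfolding maxop_def
proof (rule SUP_least)
  fix R assume "R \<in> {R \<in> rectangles. pair2 v \<in> R}"
  then obtain a b c d where R: "R = {a<..<b} \<times> {c<..<d}" "a < b" "c < d" "pair2 v \<in> R"
    unfolding rectangles_def intervals_def by auto
  have "v \<in> cbox (vec2 (a, c)) (vec2 (b, d))"
    using R(4) unfolding R(1) by (auto simp: pair2_def mem_box_cart forall_2)
  moreover have "cbox (vec2 (a, c)) (vec2 (b, d)) \<in> axis_rectangles"
    unfolding axis_rectangles_def using R
    by (intro CollectI exI[of _ "vec2 (a, c)"] exI[of _ "vec2 (b, d)"]) (simp add: forall_2)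
  ultimately show "avg R k \<le> strong_maximal K v"
    unfolding R(1) using R(2,3)
    by (intro order_trans[OF avg_le_lebesgue_average[OF assms]] le_maximal_op) auto
qed

lemma exists_small_enlargement:
  fixes s x y :: real
  assumes "ennreal (s * (x * y)) < I" "0 \<le> s" "0 < x" "0 < y"
  obtains \<delta> where "0 < \<delta>" "ennreal (s * ((x + \<delta>) * (y + \<delta>))) < I"
proof -
  have "((\<lambda>\<delta>. ennreal (s * ((x + \<delta>) * (y + \<delta>)))) \<longlongrightarrow> ennreal (s * ((x + 0) * (y + 0)))) (at_right 0)"
    by (intro tendsto_intros)
  then have "\<forall>\<^sub>F \<delta> in at_right 0. ennreal (s * ((x + \<delta>) * (y + \<delta>))) < I"
    using assms(1) by (intro order_tendstoD(2)) auto
  then have "\<forall>\<^sub>F \<delta> in at_right (0::real). 0 < \<delta> \<and> ennreal (s * ((x + \<delta>) * (y + \<delta>))) < I"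
    using eventually_at_right_less[of 0] by eventually_elim auto
  then show ?thesis
    using that by (auto dest!: eventually_happens simp: trivial_limit_at_right_real)
qed

lemma exists_rational_enlargement:
  fixes a b \<delta> :: real
  assumes "a < b" "0 < \<delta>"
  obtains a' b' where "a' \<in> \<rat>" "b' \<in> \<rat>" "a' < a" "b < b'" "b' - a' \<le> b - a + \<delta>"
proof -
  obtain a' where "a' \<in> \<rat>" "a - \<delta> / 2 < a'" "a' < a"
    using Rats_dense_in_real[of "a - \<delta> / 2" a] assms by auto
  moreover obtain b' where "b' \<in> \<rat>" "b < b'" "b' < b + \<delta> / 2"
    using Rats_dense_in_real[of b "b + \<delta> / 2"] assms by auto
  ultimately show ?thesis using that[of a' b'] by auto
qed

text \<open>The maximal function of \<open>f\<close> stands on the smaller side, so here every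
  closed rectangle has to be reached by rational open ones. An average over B above the rational
  supremum would survive a slight enlargement to a rational rectangle: the integral does not
  decrease and the area changes continuously.\<close>

lemma strong_le_maxop_rectangles:
  assumes k [measurable]: "k \<in> borel_measurable borel" and le: "AE v in lebesgue. K v \<le> k (pair2 v)"
  shows "strong_maximal K v \<le> maxop rectangles k (pair2 v)"
  unfolding maximal_op_def
proof (rule SUP_least, rule ccontr)
  fix B assume "B \<in> axis_rectangles"
  then obtain a b where B: "B = cbox a b" "a $ 1 < b $ 1" "a $ 2 < b $ 2"
    unfolding axis_rectangles_def by (auto simp: forall_2)
  assume neg: "\<not> indicator B v * ((\<integral>\<^sup>+y\<in>B. K y \<partial>lebesgue) / emeasure lebesgue B) \<le> maxop rectangles k (pair2 v)"
  then have v: "v \<in> B" by (cases "v \<in> B") auto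
  let ?x = "b $ 1 - a $ 1" and ?y = "b $ 2 - a $ 2"
  \<comment> \<open>The average over B may be infinite; a value strictly below it is finite, so s
    times an area is a real number that varies continuously.\<close>
  obtain r where r: "maxop rectangles k (pair2 v) < r" "r < (\<integral>\<^sup>+y\<in>B. K y \<partial>lebesgue) / emeasure lebesgue B"
    using neg v dense[of "maxop rectangles k (pair2 v)"] by (auto simp: not_le)
  then obtain s where s: "r = ennreal s" "0 \<le> s" by (cases r) auto
  define I where "I = (\<integral>\<^sup>+z\<in>{a $ 1..b $ 1} \<times> {a $ 2..b $ 2}. k z \<partial>lborel)"
  have B_sets: "{a $ 1..b $ 1} \<times> {a $ 2..b $ 2} \<in> sets borel" by (intro borel_Times) auto
  have "(\<integral>\<^sup>+y\<in>B. K y \<partial>lebesgue) \<le>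
      (\<integral>\<^sup>+v. k (pair2 v) * indicator ({a $ 1..b $ 1} \<times> {a $ 2..b $ 2}) (pair2 v) \<partial>lebesgue)"
    using le unfolding B(1)
    by (intro nn_integral_mono_AE)
       (auto simp: indicator_def pair2_def mem_box_cart forall_2 elim!: eventually_mono)
  also have "\<dots> = I"
    unfolding I_def
    by (intro nn_integral_lebesgue_pair2 borel_measurable_times_ennreal borel_measurable_indicator k B_sets)
  finally have KI: "(\<integral>\<^sup>+y\<in>B. K y \<partial>lebesgue) \<le> I" .
  have "ennreal (s * (?x * ?y)) < I"
  proof (rule ccontr)
    assume "\<not> ?thesis"
    then have "(\<integral>\<^sup>+y\<in>B. K y \<partial>lebesgue) \<le> ennreal (?x * ?y) * ennreal s"
      using KI s(2) B by (subst ennreal_mult[symmetric]) (auto simp: mult_ac)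
    then have "(\<integral>\<^sup>+y\<in>B. K y \<partial>lebesgue) / emeasure lebesgue B \<le> ennreal s"
      unfolding B(1) emeasure_lebesgue_cbox_vec2[OF B(2,3)]
      using B(2,3) by (intro divide_le_posI_ennreal) auto
    then show False using r(2) s(1) by simp
  qed
  then obtain \<delta> where \<delta>: "0 < \<delta>" "ennreal (s * ((?x + \<delta>) * (?y + \<delta>))) < I"
    using exists_small_enlargement[of s ?x ?y I] s(2) B by auto
  obtain a1 b1 where 1: "a1 \<in> \<rat>" "b1 \<in> \<rat>" "a1 < a $ 1" "b $ 1 < b1" "b1 - a1 \<le> ?x + \<delta>"
    using exists_rational_enlargement[OF B(2) \<delta>(1)] by blast
  obtain a2 b2 where 2: "a2 \<in> \<rat>" "b2 \<in> \<rat>" "a2 < a $ 2" "b $ 2 < b2" "b2 - a2 \<le> ?y + \<delta>"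
    using exists_rational_enlargement[OF B(3) \<delta>(1)] by blast
  define R where "R = {a1<..<b1} \<times> {a2<..<b2}"
  have lt: "a1 < b1" "a2 < b2" using 1 2 B by auto
  have "{a1<..<b1} \<in> intervals" "{a2<..<b2} \<in> intervals"
    unfolding intervals_def using 1(1,2) 2(1,2) lt by blast+
  then have R: "R \<in> rectangles" unfolding R_def rectangles_def by blast
  have "pair2 v \<in> R" using v 1 2 unfolding B(1) R_def by (auto simp: pair2_def mem_box_cart forall_2)
  then have "avg R k \<le> ennreal s"
    using avg_le_maxop[OF R, of "pair2 v" k] r(1) s(1) by simp
  then have "avg R k * emeasure lborel R \<le> ennreal s * emeasure lborel R"
    by (rule mult_right_mono) simp
  also have "\<dots> = ennreal (s * ((b1 - a1) * (b2 - a2)))"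
    using lt s(2) by (simp add: R_def emeasure_lborel_Times ennreal_mult)
  also have "\<dots> \<le> ennreal (s * ((?x + \<delta>) * (?y + \<delta>)))"
    using 1 2 lt s(2) B \<delta>(1) by (intro ennreal_leI mult_left_mono mult_mono) auto
  also have "\<dots> < I" by (rule \<delta>(2))
  also have "I \<le> (\<integral>\<^sup>+z\<in>R. k z \<partial>lborel)"
    unfolding I_def R_def using 1 2 by (intro nn_integral_mono) (auto simp: indicator_def)
  also have "\<dots> = avg R k * emeasure lborel R"
    using rectangles_emeasure[OF R] by (intro avg_mult_emeasure[symmetric]) auto
  finally show False by simp
qed

text \<open>Local integrability makes the truncations of \<open>w\<close> to the balls
  \<open>cball 0 n\<close> measurable, and at each point they are eventually equal to
  \<open>w\<close>.\<close>

lemma is_weight_measurable: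
  assumes "is_weight w"
  shows "w \<in> borel_measurable lebesgue"
proof -
  have "(\<lambda>x. indicator (cball 0 (real n)) x *\<^sub>R w x) \<in> borel_measurable lebesgue" for n
    using assms unfolding is_weight_def set_integrable_def
    by (auto intro: borel_measurable_integrable)
  moreover have "(\<lambda>n. indicator (cball 0 (real n)) x *\<^sub>R w x) \<longlonglongrightarrow> w x" for x
  proof (rule tendsto_eventually)
    show "\<forall>\<^sub>F n in sequentially. indicator (cball 0 (real n)) x *\<^sub>R w x = w x"
      using eventually_ge_at_top[of "nat \<lceil>norm x\<rceil>"]
      by eventually_elim (auto simp: indicator_def dest: le_trans nat_ceiling_le_eq[THEN iffD1])
  qed
  ultimately show ?thesis by (rule borel_measurable_LIMSEQ_metric)
qed

theorem corollary1p3: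
  fixes p :: real
  assumes "p > 1"
  shows "\<exists>C::real. C > 0 \<and>
    (\<forall>w. is_weight w \<longrightarrow>
      (let W = strong_maximal (HL_maximal (emod w)) in
        \<forall>f \<in> weighted_Lp p W.
          weighted_Lp_norm p (emod w) (strong_maximal (emod f))
            \<le> ennreal C * weighted_Lp_norm p W (emod f)))"
proof -
  obtain C where C: "0 < C"
    "\<And>w u W f. w \<in> borel_measurable borel \<Longrightarrow> u \<in> borel_measurable borel \<Longrightarrow>
      W \<in> borel_measurable borel \<Longrightarrow> f \<in> borel_measurable borel \<Longrightarrow>
      (\<And>Q x. Q \<in> axis_squares \<Longrightarrow> x \<in> Q \<Longrightarrow> avg Q w \<le> u x) \<Longrightarrow>
      (\<And>R x. R \<in> rectangles \<Longrightarrow> x \<in> R \<Longrightarrow> avg R u \<le> W x) \<Longrightarrow>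
      (\<integral>\<^sup>+x. ennreal_powr (maxop rectangles f x) p * w x \<partial>lborel) \<le>
        ennreal C * (\<integral>\<^sup>+x. ennreal_powr (f x) p * W x \<partial>lborel)"
    using rectangles_strong_type[OF assms] by blast
  \<comment> \<open>C bounds integrals of p-th powers; taking p-th roots turns it into
    C^(1/p).\<close>
  have "weighted_Lp_norm p (emod w) (strong_maximal (emod f)) \<le>
      ennreal (C powr (1 / p)) * weighted_Lp_norm p (strong_maximal (HL_maximal (emod w))) (emod f)"
    if w: "is_weight w" and f: "f \<in> borel_measurable lebesgue" for w and f :: "real^2 \<Rightarrow> complex"
  proof -
    \<comment> \<open>Lebesgue measurable data are replaced by Borel functions almost everywhere
      equal to them, which leaves all averages unchanged.\<close>
    have Borel_version: "\<exists>g'\<in>borel_measurable borel. AE v in lebesgue. g v = g' (pair2 v)"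
      if g: "g \<in> borel_measurable lebesgue" for g :: "real^2 \<Rightarrow> ennreal"
    proof -
      obtain g0 where [measurable]: "g0 \<in> borel_measurable lborel" and g0: "AE v in lborel. g v = g0 v"
        using completion_ex_borel_measurable[OF g] by blast
      have "(\<lambda>z. g0 (vec2 z)) \<in> borel_measurable borel" by measurable
      moreover have "AE v in lebesgue. g v = g0 (vec2 (pair2 v))"
        using AE_completion[OF g0] by simp
      ultimately show ?thesis by (intro bexI[of _ "\<lambda>z. g0 (vec2 z)"])
    qed
    have "emod w \<in> borel_measurable lebesgue" "emod f \<in> borel_measurable lebesgue"
      using is_weight_measurable[OF w] f unfolding emod_def[abs_def] by measurable
    from this[THEN Borel_version] obtain w' f'
      where [measurable]: "w' \<in> borel_measurable borel" "f' \<in> borel_measurable borel"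
      and w': "AE v in lebesgue. emod w v = w' (pair2 v)" and f': "AE v in lebesgue. emod f v = f' (pair2 v)"
      by (elim bexE)
    define u where "u = maxop axis_squares w'"
    define W where "W = maxop rectangles u"
    have fam: "countable rectangles" "countable axis_squares" "rectangles \<subseteq> sets borel" "axis_squares \<subseteq> sets borel"
      using countable_rectangles axis_squares_subset rectangles_sets by (auto intro: countable_subset)
    have [measurable]: "u \<in> borel_measurable borel" "W \<in> borel_measurable borel"
        "maxop rectangles f' \<in> borel_measurable borel"
      unfolding u_def W_def by (rule measurable_maxop[OF fam(2,4)] measurable_maxop[OF fam(1,3)])+
    have u_le: "u (pair2 v) \<le> HL_maximal (emod w) v" for v
      unfolding u_def using w' by (intro maxop_axis_squares_le_HL) (auto elim!: eventually_mono)
    \<comment> \<open>\<open>u_le\<close> holds at every point, so the comparison can be iterated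
      without knowing that \<open>HL_maximal (emod w)\<close> is measurable.\<close>
    have W_le: "W (pair2 v) \<le> strong_maximal (HL_maximal (emod w)) v" for v
      unfolding W_def using u_le by (intro maxop_rectangles_le_strong) auto
    have M_le: "strong_maximal (emod f) v \<le> maxop rectangles f' (pair2 v)" for v
      using f' by (intro strong_le_maxop_rectangles) (auto elim!: eventually_mono)
    have "(\<integral>\<^sup>+v. ennreal_powr (strong_maximal (emod f) v) p * emod w v \<partial>lebesgue) \<le>
        (\<integral>\<^sup>+v. ennreal_powr (maxop rectangles f' (pair2 v)) p * w' (pair2 v) \<partial>lebesgue)"
      using w' assms M_le
      by (intro nn_integral_mono_AE) (auto elim!: eventually_mono intro!: mult_mono ennreal_powr_mono)
    also have "\<dots> = (\<integral>\<^sup>+z. ennreal_powr (maxop rectangles f' z) p * w' z \<partial>lborel)"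
      by (rule nn_integral_lebesgue_pair2) measurable
    also have "\<dots> \<le> ennreal C * (\<integral>\<^sup>+z. ennreal_powr (f' z) p * W z \<partial>lborel)"
    proof (rule C(2)[where u = u])
      show "avg Q w' \<le> u x" if "Q \<in> axis_squares" "x \<in> Q" for Q x
        unfolding u_def using that by (rule avg_le_maxop)
      show "avg R u \<le> W x" if "R \<in> rectangles" "x \<in> R" for R x
        unfolding W_def using that by (rule avg_le_maxop)
    qed auto
    also have "(\<integral>\<^sup>+z. ennreal_powr (f' z) p * W z \<partial>lborel) =
        (\<integral>\<^sup>+v. ennreal_powr (f' (pair2 v)) p * W (pair2 v) \<partial>lebesgue)"
      by (rule nn_integral_lebesgue_pair2[symmetric]) measurable
    also have "\<dots> \<le> (\<integral>\<^sup>+v. ennreal_powr (emod f v) p * strong_maximal (HL_maximal (emod w)) v \<partial>lebesgue)"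
      using f' W_le by (intro nn_integral_mono_AE) (auto elim!: eventually_mono intro!: mult_left_mono)
    finally have "(\<integral>\<^sup>+v. ennreal_powr (strong_maximal (emod f) v) p * emod w v \<partial>lebesgue) \<le>
        ennreal C * (\<integral>\<^sup>+v. ennreal_powr (emod f v) p * strong_maximal (HL_maximal (emod w)) v \<partial>lebesgue)"
      by (simp add: mult_left_mono)
    from ennreal_powr_mono[OF _ this, of "1 / p"] show ?thesis
      using assms C(1) by (simp add: weighted_Lp_norm_def ennreal_powr_mult ennreal_powr_ennreal)
  qed
  moreover have "0 < C powr (1 / p)" using C(1) by simp
  ultimately show ?thesis
    by (intro exI[of _ "C powr (1 / p)"]) (auto simp: Let_def weighted_Lp_def)
qed

end
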